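(* Let $n\ge 2$, let $\sigma$ be an orientation-preserving automorphism of the cancellative hoop $G_n^+$ with dual map $S$, and let $\mathcal{C}$ be a rational cellular complex with support $[0,1]^{n-1}$ whose $(n-1)$-cells are $C_1,\dots,C_k$, together with matrices $A_1,\dots,A_k\in\mathrm{SL}_n\mathbb{Z}$ such that $A_h$ expresses $S\restriction C_h$ in positively homogeneous coordinates for each $h$. If $p$ is in the topological interior of some $(n-1)$-cell of $\mathcal{C}$, then the Jacobian matrix $J(p)$ of $S$ at $p$ is defined and $\det J(p)=[f_\sharp(p)]^{-n}$, where $f_\sharp=\sigma(\mathbf{1})$. Moreover the following are equivalent: (a) $\sigma(\mathbf{1})=\mathbf{1}$ (i.e., $\sigma$ restricts to an automorphism of the MV-algebra $\{f\in G_n:0\le f\le\mathbf{1}\}$, the free MV-algebra on $n-1$ generators); (b) for every $p\in[0,1]^{n-1}\cap\mathbb{Q}^{n-1}$, $\mathrm{den}(S(p))=\mathrm{den}(p)$; (c) for every vertex $p$ of $\mathcal{C}$, $\mathrm{den}(S(p))=\mathrm{den}(p)$; (d) the last row of every $A_h$ is $(0\cdots0\,1)$; (e) $S$ preserves the Lebesgue measure $\lambda$ on $[0,1]^{n-1}$, i.e., $\lambda(T)=\lambda(S^{-1}T)$ for every measurable $T$.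
   Context: $G_n$ is the lattice-ordered abelian group of all McNaughton functions $[0,1]^{n-1}\to\mathbb{R}$ (continuous piecewise-linear, finitely many pieces, integer coefficients) under pointwise operations; $G_n^+$ is its positive cone, the free cancellative hoop (pointwise $+$, truncated difference $0\lor(f-g)$, $0$) on free generators $x_1,\dots,x_n$, where $x_1,\dots,x_{n-1}$ are the coordinate projections, $\mathbf{1}$ is the constant function $1$, and $x_n=\mathbf{1}-(x_1\lor\cdots\lor x_{n-1})$. For an automorphism $\sigma$ of $G_n^+$, $f_i=\sigma(x_i)$ and $f_\sharp=\sigma(\mathbf{1})$ (never vanishing), and the dual map is $S(p)=(f_1(p)/f_\sharp(p),\dots,f_{n-1}(p)/f_\sharp(p))$, a homeomorphism of $[0,1]^{n-1}$; $\sigma$ is orientation-preserving if $S$ is. A rational cellular complex is a finite set of compact convex polyhedra (cells) with rational vertices, closed under faces, any two meeting in a common face. $A_h$ expresses $S\restriction C_h$ in positively homogeneous coordinates means: for $p=(\alpha_1,\dots,\alpha_{n-1})\in C_h$ and $S(p)=(\beta_1,\dots,\beta_{n-1})$, $A_h(\alpha_1,\dots,\alpha_{n-1},1)^{tr}$ is a positive multiple of $(\beta_1,\dots,\beta_{n-1},1)^{tr}$. For a rational point $p=(\alpha_1,\dots,\alpha_{n-1})$, its primitive homogeneous coordinates are the integer coordinates $(a_1,\dots,a_n)$ of the unique vector in $\mathbb{Z}^n\cap\mathbb{R}^+(\alpha_1,\dots,\alpha_{n-1},1)$ with relatively prime entries, and $\mathrm{den}(p)=a_n$. *)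

theory Defs
  imports "HOL-Analysis.Analysis" "HOL-Homology.Homology"
begin

text \<open>
  Conventions.  The index type \<open>'m\<close> enumerates the \<open>n - 1\<close> coordinates of the cube, so
  \<open>n = CARD('m) + 1 \<ge> 2\<close>.  The \<open>n\<close> homogeneous coordinates are indexed by \<open>'m option\<close>,
  with \<^const>\<open>None\<close> as the last index.  A function on the cube is represented by its
  extensional representative (\<^const>\<open>undefined\<close> off the cube), so that equality of functions is
  equality on the cube.
\<close>

definition unit_cube :: "(real ^ 'm) set" where
  "unit_cube = cbox 0 1"


subsection \<open>McNaughton functions, the hoop of positive functions and the MV-algebra\<close>

definition mcnaughton :: "(real ^ 'm \<Rightarrow> real) set" where
  "mcnaughton = {f \<in> extensional unit_cube. continuous_on unit_cube f \<and>
     (\<exists>L :: ((int ^ 'm) \<times> int) set. finite L \<and>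
        (\<forall>p\<in>unit_cube. \<exists>(a, b)\<in>L. f p = (\<Sum>i\<in>UNIV. of_int (a $ i) * p $ i) + of_int b))}"

definition mcnaughton_pos :: "(real ^ 'm \<Rightarrow> real) set" where
  "mcnaughton_pos = {f \<in> mcnaughton. \<forall>p\<in>unit_cube. 0 \<le> f p}"

definition const_fun :: "real \<Rightarrow> real ^ 'm \<Rightarrow> real" where
  "const_fun c = (\<lambda>p\<in>unit_cube. c)"

definition coord_fun :: "'m \<Rightarrow> real ^ 'm \<Rightarrow> real" where
  "coord_fun i = (\<lambda>p\<in>unit_cube. p $ i)"

definition hoop_add :: "(real ^ 'm \<Rightarrow> real) \<Rightarrow> (real ^ 'm \<Rightarrow> real) \<Rightarrow> real ^ 'm \<Rightarrow> real" where
  "hoop_add f g = (\<lambda>p\<in>unit_cube. f p + g p)"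

definition hoop_diff :: "(real ^ 'm \<Rightarrow> real) \<Rightarrow> (real ^ 'm \<Rightarrow> real) \<Rightarrow> real ^ 'm \<Rightarrow> real" where
  "hoop_diff f g = (\<lambda>p\<in>unit_cube. max 0 (f p - g p))"

definition hoop_automorphism ::
    "((real ^ 'm \<Rightarrow> real) \<Rightarrow> (real ^ 'm \<Rightarrow> real)) \<Rightarrow> bool" where
  "hoop_automorphism \<sigma> \<longleftrightarrow>
     bij_betw \<sigma> mcnaughton_pos mcnaughton_pos \<and>
     (\<forall>f\<in>mcnaughton_pos. \<forall>g\<in>mcnaughton_pos. \<sigma> (hoop_add f g) = hoop_add (\<sigma> f) (\<sigma> g)) \<and>
     (\<forall>f\<in>mcnaughton_pos. \<forall>g\<in>mcnaughton_pos. \<sigma> (hoop_diff f g) = hoop_diff (\<sigma> f) (\<sigma> g)) \<and>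
     \<sigma> (const_fun 0) = const_fun 0"

definition mcnaughton_unit :: "(real ^ 'm \<Rightarrow> real) set" where
  "mcnaughton_unit = {f \<in> mcnaughton. \<forall>p\<in>unit_cube. 0 \<le> f p \<and> f p \<le> 1}"

definition mv_add :: "(real ^ 'm \<Rightarrow> real) \<Rightarrow> (real ^ 'm \<Rightarrow> real) \<Rightarrow> real ^ 'm \<Rightarrow> real" where
  "mv_add f g = (\<lambda>p\<in>unit_cube. min 1 (f p + g p))"

definition mv_neg :: "(real ^ 'm \<Rightarrow> real) \<Rightarrow> real ^ 'm \<Rightarrow> real" where
  "mv_neg f = (\<lambda>p\<in>unit_cube. 1 - f p)"

definition restricts_to_mv_automorphism ::
    "((real ^ 'm \<Rightarrow> real) \<Rightarrow> (real ^ 'm \<Rightarrow> real)) \<Rightarrow> bool" where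
  "restricts_to_mv_automorphism \<sigma> \<longleftrightarrow>
     bij_betw \<sigma> mcnaughton_unit mcnaughton_unit \<and>
     (\<forall>f\<in>mcnaughton_unit. \<forall>g\<in>mcnaughton_unit. \<sigma> (mv_add f g) = mv_add (\<sigma> f) (\<sigma> g)) \<and>
     (\<forall>f\<in>mcnaughton_unit. \<sigma> (mv_neg f) = mv_neg (\<sigma> f)) \<and>
     \<sigma> (const_fun 0) = const_fun 0"


subsection \<open>The dual map and orientation\<close>

definition dual_map :: "((real ^ 'm \<Rightarrow> real) \<Rightarrow> (real ^ 'm \<Rightarrow> real)) \<Rightarrow> real ^ 'm \<Rightarrow> real ^ 'm" where
  "dual_map \<sigma> p = (\<chi> i. \<sigma> (coord_fun i) p / \<sigma> (const_fun 1) p)"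

text \<open>
  A homeomorphism of the cube preserves orientation iff it has degree one, i.e. acts as the identity
  on the top relative homology group of the pair (cube, boundary), which is infinite cyclic.
\<close>

definition orientation_preserving_on_cube :: "(real ^ 'm \<Rightarrow> real ^ 'm) \<Rightarrow> bool" where
  "orientation_preserving_on_cube S \<longleftrightarrow>
     (\<forall>c \<in> carrier (relative_homology_group (int CARD('m)) (top_of_set unit_cube)
                      (frontier unit_cube)).
        hom_induced (int CARD('m)) (top_of_set unit_cube) (frontier unit_cube)
          (top_of_set unit_cube) (frontier unit_cube) S c = c)"


subsection \<open>Rational points, homogeneous coordinates and denominators\<close>

definition rational_point :: "real ^ 'm \<Rightarrow> bool" where
  "rational_point p \<longleftrightarrow> (\<forall>i. p $ i \<in> \<rat>)"

definition homogeneous :: "real ^ 'm \<Rightarrow> real ^ 'm option" where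
  "homogeneous p = (\<chi> j. case j of None \<Rightarrow> 1 | Some i \<Rightarrow> p $ i)"

definition primitive_coords :: "real ^ 'm \<Rightarrow> int ^ 'm option" where
  "primitive_coords p = (THE a. (\<exists>c>0. (\<chi> j. of_int (a $ j)) = c *\<^sub>R homogeneous p) \<and>
                                Gcd (range (($) a)) = 1)"

definition den :: "real ^ 'm \<Rightarrow> int" where
  "den p = primitive_coords p $ None"

definition expresses_on ::
    "int ^ 'm option ^ 'm option \<Rightarrow> (real ^ 'm \<Rightarrow> real ^ 'm) \<Rightarrow> (real ^ 'm) set \<Rightarrow> bool" where
  "expresses_on A S D \<longleftrightarrow>
     (\<forall>p\<in>D. \<exists>c>0. map_matrix of_int A *v homogeneous p = c *\<^sub>R homogeneous (S p))"


subsection \<open>Rational cellular complexes\<close>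

text \<open>
  In the library the empty set is a face of every polytope.  Disjoint cells thus meet in the common
  face \<open>{}\<close>, and whether \<open>{}\<close> itself counts as a cell is left open.
\<close>

definition rational_cellular_complex :: "(real ^ 'm) set set \<Rightarrow> bool" where
  "rational_cellular_complex \<C> \<longleftrightarrow>
     finite \<C> \<and>
     (\<forall>D\<in>\<C>. polytope D \<and> (\<forall>v. v extreme_point_of D \<longrightarrow> rational_point v)) \<and>
     (\<forall>D\<in>\<C>. \<forall>F. F face_of D \<and> F \<noteq> {} \<longrightarrow> F \<in> \<C>) \<and>
     (\<forall>D\<in>\<C>. \<forall>E\<in>\<C>. (D \<inter> E) face_of D \<and> (D \<inter> E) face_of E)"

definition complex_vertices :: "(real ^ 'm) set set \<Rightarrow> (real ^ 'm) set" where
  "complex_vertices \<C> = {v. \<exists>D\<in>\<C>. v extreme_point_of D}"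


subsection \<open>Preservation of the Lebesgue measure\<close>

definition preserves_lebesgue_on_cube :: "(real ^ 'm \<Rightarrow> real ^ 'm) \<Rightarrow> bool" where
  "preserves_lebesgue_on_cube S \<longleftrightarrow>
     (\<forall>T\<in>sets lebesgue. T \<subseteq> unit_cube \<longrightarrow>
        S -` T \<inter> unit_cube \<in> sets lebesgue \<and>
        emeasure lebesgue T = emeasure lebesgue (S -` T \<inter> unit_cube))"

end

theory Submission
  imports Defs
begin

text \<open>
  Write \<open>f\<^sub>1 = \<sigma>(1)\<close>.  Evaluating \<open>\<sigma> g\<close> at a point \<open>p\<close> gives a homomorphism into the reals, and
  approximation by integer combinations of the generators shows \<open>\<sigma> g p = f\<^sub>1(p) g(S p)\<close>.  At a
  rational point \<open>p\<close> the vector \<open>den(p) f\<^sub>1(p) (S p, 1)\<close> is integral, whence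
  \<open>den(S p) \<le> den(p) f\<^sub>1(p)\<close>; the same bound for the inverse automorphism turns this into an equality.
  A matrix in \<open>SL\<^sub>n(\<int>)\<close> maps primitive vectors to primitive vectors, so on \<open>C\<^sub>h\<close> the last row of \<open>A\<^sub>h\<close>
  takes the value \<open>den(S p) / den(p) = f\<^sub>1(p)\<close> first at rational and then, by density, at all points.
  Hence on each cell \<open>S\<close> is a projective map with denominator \<open>f\<^sub>1\<close> and Jacobian
  determinant \<open>f\<^sub>1\<^sup>-\<^sup>n\<close>, and each of the conditions says that the affine function \<open>f\<^sub>1\<close> is \<open>1\<close> on every cell.
\<close>

subsection \<open>Determinants and change of variables over finite index types\<close>

text \<open>Two obstacles shape the argument. First, \<open>expresses_on\<close> equates the image
  of (p, 1) under the matrix with (S p, 1) only up to a positive factor depending on p, so by itself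
  it does not tie the last row of \<open>A h\<close> to \<open>f\<^sub>1\<close>; the arithmetic of
  denominators does. Second, a hoop automorphism respects sums and truncated differences but offers
  no real multiples. An approximation of g near S p must therefore be scaled by a large natural
  number b before its coefficients are rounded to integers; the rounding error does not grow with b,
  so dividing by b removes it. The exponent of the Jacobian is n = \<open>CARD('m) + 1\<close>: each
  of the \<open>CARD('m)\<close> rows of the derivative of a quotient carries a factor 1 /
  \<open>f\<^sub>1\<close>, and one more comes from the determinant of \<open>A h\<close>, whose
  corner entry is \<open>f\<^sub>1\<close> once its last column is cleared. In condition (e) the two
  directions use different test sets: images of boxes inside one cell already force
  \<open>f\<^sub>1\<close> to be 1, whereas preservation is proved for an arbitrary measurable set
  by cutting it along the images of the cells.\<close>

lemma bij_betw_map_permutation: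
  assumes "inj (f :: 'a::finite \<Rightarrow> 'b)"
  shows "bij_betw (map_permutation UNIV f) {p. p permutes UNIV} {p. p permutes range f}"
proof (rule bij_betwI[where g = "map_permutation (range f) (inv_into UNIV f)"])
  have f: "bij_betw f UNIV (range f)" and g: "bij_betw (inv_into UNIV f) (range f) UNIV"
    using assms by (auto simp: bij_betw_def inj_on_def)
  show "map_permutation UNIV f \<in> {p. p permutes UNIV} \<rightarrow> {p. p permutes range f}"
    using map_permutation_permutes[OF f] by auto
  show "map_permutation (range f) (inv_into UNIV f) \<in> {p. p permutes range f} \<rightarrow> {p. p permutes UNIV}"
    using map_permutation_permutes[OF g] by auto
  show "map_permutation (range f) (inv_into UNIV f) (map_permutation UNIV f p) = p"
    if "p \<in> {p. p permutes UNIV}" for p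
    using that assms by (intro map_permutation_compose_inv[OF f]) auto
  show "map_permutation UNIV f (map_permutation (range f) (inv_into UNIV f) p) = p"
    if "p \<in> {p. p permutes range f}" for p
    using that by (intro map_permutation_compose_inv[OF g]) (auto simp: f_inv_into_f)
qed

text \<open>A bijective \<open>f\<close> renames the indices; \<open>f = Some\<close> recognises the
  minor left by an expansion along the index \<open>None\<close>. Conjugation by \<open>f\<close>
  carries the permutations over and keeps their signs.\<close>

lemma sum_permutes_range:
  fixes f :: "'a::finite \<Rightarrow> 'b::finite" and A :: "'c::comm_ring_1 ^ 'b ^ 'b"
  assumes "inj f"
  shows "(\<Sum>p | p permutes range f. of_int (sign p) * (\<Prod>i\<in>range f. A $ i $ p i))
       = det (\<chi> i j. A $ f i $ f j)"
proof -
  have "det (\<chi> i j. A $ f i $ f j) = (\<Sum>p | p permutes (UNIV::'a set).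
      of_int (sign (map_permutation UNIV f p)) *
      (\<Prod>i\<in>range f. A $ i $ map_permutation UNIV f p i))"
    unfolding det_def using assms
    by (intro sum.cong refl)
       (simp add: sign_map_permutation prod.reindex map_permutation_apply)
  also have "\<dots> = (\<Sum>p | p permutes range f. of_int (sign p) * (\<Prod>i\<in>range f. A $ i $ p i))"
    by (rule sum.reindex_bij_betw[OF bij_betw_map_permutation[OF assms]])
  finally show ?thesis ..
qed

lemma det_reindex:
  fixes A :: "'c::comm_ring_1 ^ 'b ^ 'b"
  assumes "bij (f :: 'a::finite \<Rightarrow> 'b)"
  shows "det (\<chi> i j. A $ f i $ f j) = det A"
  using sum_permutes_range[of f A] assms unfolding det_def by (simp add: bij_def)

text \<open>In the Leibniz sum a permutation that moves \<open>None\<close> sends some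
  \<open>Some i\<close> to \<open>None\<close> and so picks a zero entry. The surviving permutations
  fix \<open>None\<close>, and the corner entry factors out.\<close>

lemma det_option_last_column:
  fixes A :: "'c::comm_ring_1 ^ ('m::finite) option ^ 'm option"
  assumes "\<And>i. A $ Some i $ None = 0"
  shows "det A = A $ None $ None * det (\<chi> i j. A $ Some i $ Some j)"
proof -
  let ?t = "\<lambda>p. of_int (sign p) * (\<Prod>i\<in>UNIV. A $ i $ p i)"
  have UNIV_eq: "(UNIV :: 'm option set) = insert None (range Some)"
    by (auto simp: UNIV_option_conv)
  have prod_eq: "(\<Prod>i\<in>UNIV. A $ i $ p i) = A $ None $ p None * (\<Prod>i\<in>range Some. A $ i $ p i)"
    for p :: "'m option \<Rightarrow> 'm option"
    unfolding UNIV_eq by (subst prod.insert) auto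
  have sub: "{p. p permutes range Some} \<subseteq> {p. p permutes (UNIV :: 'm option set)}"
    using permutes_subset by blast
  have zero: "?t p = 0" if p: "p permutes (UNIV :: 'm option set)" "\<not> p permutes range Some" for p
  proof -
    have "p None \<noteq> None"
    proof
      assume "p None = None"
      then have "p permutes range Some"
        using p(1) unfolding permutes_def by (metis notin_range_Some)
      then show False using p(2) by blast
    qed
    moreover obtain j where j: "p j = None"
      using p(1) by (metis permutes_univ)
    ultimately obtain i where "j = Some i" by (cases j) auto
    then have "\<exists>i\<in>UNIV. A $ i $ p i = 0" using assms j by (intro bexI[of _ j]) auto
    then have "(\<Prod>i\<in>UNIV. A $ i $ p i) = 0" by (simp add: prod_zero)
    then show ?thesis by simp
  qed
  have "det A = (\<Sum>p | p permutes range Some. ?t p)"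
    unfolding det_def using sub zero by (intro sum.mono_neutral_right finite_permutations) auto
  also have "\<dots> = (\<Sum>p | p permutes range Some. A $ None $ None *
      (of_int (sign p) * (\<Prod>i\<in>range Some. A $ i $ p i)))"
    by (intro sum.cong refl) (auto simp: prod_eq permutes_def)
  also have "\<dots> = A $ None $ None * det (\<chi> i j. A $ Some i $ Some j)"
    by (simp add: sum_distrib_left[symmetric] sum_permutes_range)
  finally show ?thesis .
qed

lemma det_map_matrix_of_int:
  "det (map_matrix of_int A :: 'a::comm_ring_1 ^ 'n ^ 'n) = of_int (det A)"
  unfolding det_def by simp

text \<open>The change of variables formula of the library needs a well-ordered index type.  It is
  transported to an arbitrary finite index type along a bijection with this well-ordered copy.\<close>

typedef 'm index = "{..<CARD('m::finite)}"
  by (rule exI[of _ 0]) simp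

instantiation index :: (finite) wellorder
begin
definition less_eq_index :: "'a index \<Rightarrow> 'a index \<Rightarrow> bool" where
  "less_eq_index i j \<longleftrightarrow> Rep_index i \<le> Rep_index j"
definition less_index :: "'a index \<Rightarrow> 'a index \<Rightarrow> bool" where
  "less_index i j \<longleftrightarrow> Rep_index i < Rep_index j"
instance
proof
  fix P :: "'a index \<Rightarrow> bool" and a
  assume step: "\<And>i. (\<And>j. j < i \<Longrightarrow> P j) \<Longrightarrow> P i"
  show "P a"
    by (induction a rule: measure_induct_rule[of Rep_index]) (auto simp: less_index_def intro: step)
qed (auto simp: less_eq_index_def less_index_def Rep_index_inject)
end

instance index :: (finite) finite
  by standard (simp add: type_definition.univ[OF type_definition_index])

lemma ex_bij_index: "\<exists>f :: 'm::finite index \<Rightarrow> 'm. bij f"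
proof -
  have "card (UNIV :: 'm index set) = CARD('m)"
    by (simp add: type_definition.card[OF type_definition_index])
  then show ?thesis
    using finite_same_card_bij[of "UNIV :: 'm index set" "UNIV :: 'm set"] by auto
qed

section \<open>Integrals and measures under a renaming of the coordinates\<close>

context
  fixes r :: "'a::finite \<Rightarrow> 'b::finite"
  assumes r: "bij r"
begin

lemma reindex_reindex_inv: "(\<chi> j. (\<chi> i. x $ r i) $ inv_into UNIV r j) = (x :: real ^ 'b)"
  using r by (simp add: vec_eq_iff bij_is_surj surj_f_inv_f)

lemma reindex_inv_reindex: "(\<chi> i. (\<chi> j. x $ inv_into UNIV r j) $ r i) = (x :: real ^ 'a)"
  using r by (simp add: vec_eq_iff bij_is_inj inv_f_f)

lemma reindex_image_cbox:
  "(\<lambda>x :: real ^ 'b. \<chi> i. x $ r i) ` cbox u v = cbox (\<chi> i. u $ r i) (\<chi> i. v $ r i)"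
proof (intro equalityI subsetI)
  fix y :: "real ^ 'a"
  assume y: "y \<in> cbox (\<chi> i. u $ r i) (\<chi> i. v $ r i)"
  have "u $ j \<le> y $ inv_into UNIV r j \<and> y $ inv_into UNIV r j \<le> v $ j" for j
  proof -
    have "u $ r (inv_into UNIV r j) \<le> y $ inv_into UNIV r j \<and> y $ inv_into UNIV r j \<le> v $ r (inv_into UNIV r j)"
      using y by (simp add: mem_box_cart)
    then show ?thesis using r by (simp add: bij_is_surj surj_f_inv_f)
  qed
  then show "y \<in> (\<lambda>x. \<chi> i. x $ r i) ` cbox u v"
    by (intro image_eqI[where x = "\<chi> j. y $ inv_into UNIV r j"])
       (use r in \<open>simp_all add: mem_box_cart vec_eq_iff bij_is_inj\<close>)
qed (auto simp: mem_box_cart)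

lemma content_reindex_image_cbox:
  "measure lborel ((\<lambda>x :: real ^ 'b. \<chi> i. x $ r i) ` cbox u v) = measure lborel (cbox u v)"
proof (cases "cbox u v = {}")
  case False
  have "(\<Prod>i\<in>UNIV. v $ r i - u $ r i) = (\<Prod>j\<in>UNIV. v $ j - u $ j)"
    by (rule prod.reindex_bij_betw[OF r])
  moreover have "cbox (\<chi> i. u $ r i) (\<chi> i. v $ r i) \<noteq> {}"
    using False unfolding reindex_image_cbox[symmetric] by simp
  ultimately show ?thesis
    using False by (simp add: reindex_image_cbox content_cbox_cart)
qed simp

lemma linear_reindex: "linear (\<lambda>x :: real ^ 'b. \<chi> i. x $ r i)"
  by (rule linearI) (auto simp: vec_eq_iff)

end

text \<open>\<open>has_integral_twiddle\<close> speaks of boxes, so \<open>f\<close> is extended by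
  zero from the bounded set \<open>S\<close> to a box. Renaming coordinates carries boxes to boxes
  of equal content, so the scale factor is 1.\<close>

lemma has_integral_reindex:
  fixes r :: "'a::finite \<Rightarrow> 'b::finite" and f :: "real ^ 'b \<Rightarrow> real"
  assumes r: "bij r" and "bounded S" and f: "(f has_integral I) S"
  shows "((\<lambda>y. f (\<chi> j. y $ inv_into UNIV r j)) has_integral I) ((\<lambda>x. \<chi> i. x $ r i) ` S)"
proof -
  let ?h = "\<lambda>x :: real ^ 'b. \<chi> i. x $ r i" and ?g = "\<lambda>y :: real ^ 'a. \<chi> j. y $ inv_into UNIV r j"
  let ?F = "\<lambda>x. if x \<in> S then f x else 0"
  note bij_inv = bij_imp_bij_inv[OF r]
  obtain a where a: "S \<subseteq> cbox (-a) a"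
    using bounded_subset_cbox_symmetric[OF \<open>bounded S\<close>] by blast
  have F: "(?F has_integral I) (cbox (-a) a)"
    using f a by (simp add: has_integral_restrict)
  have "((\<lambda>y. ?F (?g y)) has_integral (1 / 1) *\<^sub>R I) (?h ` cbox (-a) a)"
  proof (rule has_integral_twiddle[OF _ _ _ _ _ _ _ F])
    show "\<And>x. continuous (at x) ?g"
      using linear_reindex[OF bij_inv] by (simp add: linear_continuous_at linear_conv_bounded_linear)
    show "\<And>x. ?h (?g x) = x" "\<And>x. ?g (?h x) = x"
      using reindex_inv_reindex[OF r] reindex_reindex_inv[OF r] by auto
    show "\<And>u v. \<exists>w z. ?g ` cbox u v = cbox w z" "\<And>u v. \<exists>w z. ?h ` cbox u v = cbox w z"
      using reindex_image_cbox[OF r] reindex_image_cbox[OF bij_inv] by blast+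
    show "\<And>u v. measure lborel (?g ` cbox u v) = 1 * measure lborel (cbox u v)"
      using content_reindex_image_cbox[OF bij_inv] by simp
  qed simp
  moreover have "?g y \<in> S \<longleftrightarrow> y \<in> ?h ` S" for y
  proof
    assume "?g y \<in> S"
    then have "?h (?g y) \<in> ?h ` S" by (rule imageI)
    then show "y \<in> ?h ` S" by (simp only: reindex_inv_reindex[OF r])
  next
    assume "y \<in> ?h ` S"
    then obtain x where "x \<in> S" "y = ?h x" by blast
    then show "?g y \<in> S" by (simp only: reindex_reindex_inv[OF r])
  qed
  moreover have "?h ` S \<subseteq> ?h ` cbox (-a) a"
    using a by blast
  ultimately show ?thesis
    by (simp add: has_integral_restrict)
qed

lemma lmeasurable_reindex:
  fixes r :: "'a::finite \<Rightarrow> 'b::finite" and S :: "(real ^ 'b) set"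
  assumes r: "bij r" and "bounded S" "S \<in> lmeasurable"
  shows "(\<lambda>x. \<chi> i. x $ r i) ` S \<in> lmeasurable"
    and "measure lebesgue ((\<lambda>x. \<chi> i. x $ r i) ` S) = measure lebesgue S"
proof -
  have "((\<lambda>x. 1) has_integral measure lebesgue S) S"
    using assms by (simp add: lmeasure_integral lmeasurable_iff_integrable_on integrable_integral)
  from has_integral_reindex[OF r \<open>bounded S\<close> this]
  have *: "((\<lambda>x. 1::real) has_integral measure lebesgue S) ((\<lambda>x. \<chi> i. x $ r i) ` S)" .
  then show m: "(\<lambda>x. \<chi> i. x $ r i) ` S \<in> lmeasurable"
    by (auto simp: lmeasurable_iff_integrable_on)
  show "measure lebesgue ((\<lambda>x. \<chi> i. x $ r i) ` S) = measure lebesgue S"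
    using * lmeasure_integral[OF m] by (simp add: integral_unique)
qed

text \<open>The formula is applied to the conjugate of \<open>f\<close> by the renaming
  \<open>h\<close>. Its Jacobian matrix is that of \<open>f\<close> with rows and columns renamed
  alike, hence has the same determinant. Boundedness of \<open>S\<close> and of its image allows
  \<open>lmeasurable_reindex\<close> to carry measures there and back.\<close>

lemma has_measure_differentiable_image_bounded:
  fixes f :: "real ^ 'm \<Rightarrow> real ^ 'm"
  assumes S: "S \<in> lmeasurable" "bounded S" and bfS: "bounded (f ` S)"
    and der: "\<And>x. x \<in> S \<Longrightarrow> (f has_derivative f' x) (at x within S)"
    and inj: "inj_on f S"
    and int: "((\<lambda>x. \<bar>det (matrix (f' x))\<bar>) has_integral I) S"
  shows "f ` S \<in> lmeasurable" and "measure lebesgue (f ` S) = I"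
proof -
  obtain r :: "'m index \<Rightarrow> 'm" where r: "bij r"
    using ex_bij_index by blast
  define h where "h = (\<lambda>x :: real ^ 'm. \<chi> i. x $ r i)"
  define g where "g = (\<lambda>y :: real ^ 'm index. \<chi> j. y $ inv_into UNIV r j)"
  note r' = bij_imp_bij_inv[OF r]
  have hg [simp]: "h (g x) = x" and gh [simp]: "g (h y) = y" for x y
    unfolding h_def g_def using reindex_inv_reindex[OF r] reindex_reindex_inv[OF r] by auto
  have ghS: "g ` h ` X = X" for X
    by (simp add: image_image)
  define k where "k = h \<circ> f \<circ> g"
  define k' where "k' y = h \<circ> f' (g y) \<circ> g" for y
  have kS: "k ` h ` S = h ` f ` S"
    unfolding k_def by (simp add: image_image o_def)
  have lin: "bounded_linear h" "bounded_linear g"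
    using linear_reindex[OF r] linear_reindex[OF r'] by (simp_all add: h_def g_def linear_conv_bounded_linear)
  have der_k: "(k has_derivative k' y) (at y within h ` S)" if "y \<in> h ` S" for y
  proof -
    have y: "g y \<in> S" using that by auto
    have "(g has_derivative g) (at y within h ` S)"
      using lin by (simp add: bounded_linear_imp_has_derivative)
    moreover have "(f has_derivative f' (g y)) (at (g y) within g ` h ` S)"
      using der[OF y] by (simp only: ghS)
    ultimately have "(f \<circ> g has_derivative f' (g y) \<circ> g) (at y within h ` S)"
      by (rule diff_chain_within)
    moreover have "(h has_derivative h) (at ((f \<circ> g) y) within (f \<circ> g) ` h ` S)"
      using lin by (simp add: bounded_linear_imp_has_derivative)
    ultimately have "(h \<circ> (f \<circ> g) has_derivative h \<circ> (f' (g y) \<circ> g)) (at y within h ` S)"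
      by (rule diff_chain_within)
    then show ?thesis unfolding k_def k'_def by (simp add: comp_assoc)
  qed
  have inj_k: "inj_on k (h ` S)"
  proof (rule inj_onI)
    fix x y assume "x \<in> h ` S" "y \<in> h ` S" "k x = k y"
    then obtain u v where uv: "u \<in> S" "v \<in> S" "x = h u" "y = h v" "h (f u) = h (f v)"
      by (auto simp: k_def)
    then have "f u = f v" by (metis gh)
    then show "x = y" using inj uv by (auto dest: inj_onD)
  qed
  have det_k: "det (matrix (k' y)) = det (matrix (f' (g y)))" for y
  proof -
    have g_axis: "g (axis j 1) = axis (r j) 1" for j
      using r by (auto simp: g_def vec_eq_iff axis_def bij_is_inj bij_is_surj surj_f_inv_f)
    have "matrix (k' y) = (\<chi> i j. matrix (f' (g y)) $ r i $ r j)"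
      unfolding matrix_def k'_def o_def g_axis by (simp add: h_def)
    then show ?thesis using det_reindex[OF r] by simp
  qed
  have "((\<lambda>y. \<bar>det (matrix (f' (g y)))\<bar>) has_integral I) (h ` S)"
    using has_integral_reindex[OF r S(2) int] unfolding h_def g_def .
  then have int_k: "((\<lambda>y. \<bar>det (matrix (k' y))\<bar>) has_integral I) (h ` S)"
    by (simp add: det_k)
  have hS: "h ` S \<in> sets lebesgue"
    using lmeasurable_reindex(1)[OF r S(2,1)] by (simp add: h_def fmeasurableD)
  have m: "h ` f ` S \<in> lmeasurable" "measure lebesgue (h ` f ` S) = I"
    using has_measure_differentiable_image[OF hS der_k inj_k] int_k unfolding kS by blast+
  have b: "bounded (h ` f ` S)"
    using bounded_linear_image[OF bfS lin(1)] .
  have "g ` h ` f ` S \<in> lmeasurable \<and> measure lebesgue (g ` h ` f ` S) = measure lebesgue (h ` f ` S)"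
    using lmeasurable_reindex[OF r' b m(1)] unfolding g_def by blast
  then show "f ` S \<in> lmeasurable" "measure lebesgue (f ` S) = I"
    using m(2) unfolding ghS by auto
qed

subsection \<open>The dual representation of an automorphism\<close>

definition int_affine :: "(int ^ 'm) \<times> int \<Rightarrow> real ^ 'm \<Rightarrow> real" where
  "int_affine = (\<lambda>(a, b) p. (\<Sum>i\<in>UNIV. of_int (a $ i) * p $ i) + of_int b)"

lemma mcnaughton_iff:
  "f \<in> mcnaughton \<longleftrightarrow> f \<in> extensional unit_cube \<and> continuous_on unit_cube f \<and>
     (\<exists>L. finite L \<and> (\<forall>p\<in>unit_cube. \<exists>l\<in>L. f p = int_affine l p))"
  unfolding mcnaughton_def int_affine_def by (auto simp: case_prod_unfold)

lemma int_affine_diff: "int_affine l p - int_affine l' p = int_affine (l - l') p"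
  by (cases l; cases l') (simp add: int_affine_def sum_subtractf algebra_simps)

lemma int_affine_add: "int_affine l p + int_affine l' p = int_affine (l + l') p"
  by (cases l; cases l') (simp add: int_affine_def sum.distrib algebra_simps)

lemma mcnaughton_posD:
  assumes "f \<in> mcnaughton_pos"
  shows "f \<in> extensional unit_cube" "continuous_on unit_cube f" "\<And>p. p \<in> unit_cube \<Longrightarrow> 0 \<le> f p"
  using assms by (auto simp: mcnaughton_pos_def mcnaughton_iff)

lemma mcnaughton_eqI:
  assumes "f \<in> mcnaughton_pos" "g \<in> mcnaughton_pos" "\<And>p. p \<in> unit_cube \<Longrightarrow> f p = g p"
  shows "f = g"
  using assms by (intro extensionalityI[of _ unit_cube]) (auto dest: mcnaughton_posD)

lemma mcnaughton_posI:
  assumes "finite L" "\<And>p. p \<in> unit_cube \<Longrightarrow> \<exists>l\<in>L. f p = int_affine l p"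
    and "continuous_on unit_cube f" "\<And>p. p \<in> unit_cube \<Longrightarrow> 0 \<le> f p"
  shows "restrict f unit_cube \<in> mcnaughton_pos"
proof -
  have "\<forall>p\<in>unit_cube. \<exists>l\<in>L. restrict f unit_cube p = int_affine l p"
    using assms(2) by simp
  moreover have "continuous_on unit_cube (restrict f unit_cube)"
    using assms(3) by simp
  ultimately show ?thesis
    using assms(1,4) unfolding mcnaughton_pos_def mcnaughton_iff by auto
qed

section \<open>Closure of the positive cone under the hoop operations\<close>

lemma hoop_add_mem:
  assumes "f \<in> mcnaughton_pos" "g \<in> mcnaughton_pos"
  shows "hoop_add f g \<in> mcnaughton_pos"
proof -
  obtain L K where L: "finite L" "\<forall>p\<in>unit_cube. \<exists>l\<in>L. f p = int_affine l p"
    and K: "finite K" "\<forall>p\<in>unit_cube. \<exists>l\<in>K. g p = int_affine l p"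
    using assms by (auto simp: mcnaughton_pos_def mcnaughton_iff)
  show ?thesis
    unfolding hoop_add_def
  proof (rule mcnaughton_posI)
    show "finite ((\<lambda>(l, l'). l + l') ` (L \<times> K))" using L(1) K(1) by blast
    show "\<exists>l\<in>(\<lambda>(l, l'). l + l') ` (L \<times> K). f p + g p = int_affine l p" if p: "p \<in> unit_cube" for p
    proof -
      obtain l l' where "l \<in> L" "l' \<in> K" "f p = int_affine l p" "g p = int_affine l' p"
        using L K p by blast
      then show ?thesis by (intro bexI[of _ "l + l'"]) (auto simp: int_affine_add)
    qed
    show "continuous_on unit_cube (\<lambda>p. f p + g p)"
      using assms by (intro continuous_intros) (auto dest: mcnaughton_posD)
  qed (simp add: assms mcnaughton_posD)
qed

lemma hoop_diff_mem:
  assumes "f \<in> mcnaughton_pos" "g \<in> mcnaughton_pos"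
  shows "hoop_diff f g \<in> mcnaughton_pos"
proof -
  obtain L K where L: "finite L" "\<forall>p\<in>unit_cube. \<exists>l\<in>L. f p = int_affine l p"
    and K: "finite K" "\<forall>p\<in>unit_cube. \<exists>l\<in>K. g p = int_affine l p"
    using assms by (auto simp: mcnaughton_pos_def mcnaughton_iff)
  \<comment> \<open>The form \<open>0\<close> serves the points where the difference is
    truncated.\<close>
  let ?M = "insert 0 ((\<lambda>(l, l'). l - l') ` (L \<times> K))"
  have "\<exists>l\<in>?M. max 0 (f p - g p) = int_affine l p" if p: "p \<in> unit_cube" for p
  proof (cases "f p \<le> g p")
    case True
    then have "max 0 (f p - g p) = int_affine 0 p"
      by (simp add: int_affine_def zero_prod_def)
    then show ?thesis by blast
  next
    case False
    obtain l l' where "l \<in> L" "l' \<in> K" "f p = int_affine l p" "g p = int_affine l' p"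
      using L K p by blast
    then have "max 0 (f p - g p) = int_affine (l - l') p" "(l, l') \<in> L \<times> K"
      using False by (simp_all add: int_affine_diff[symmetric])
    then show ?thesis by force
  qed
  moreover have "continuous_on unit_cube (\<lambda>p. max 0 (f p - g p))"
    using assms by (intro continuous_intros) (auto dest: mcnaughton_posD)
  moreover have "finite ?M" using L(1) K(1) by blast
  ultimately show ?thesis
    unfolding hoop_diff_def by (intro mcnaughton_posI[of ?M]) auto
qed

lemma const_fun_mem: "const_fun (of_nat n) \<in> mcnaughton_pos"
  unfolding const_fun_def
  by (rule mcnaughton_posI[of "{(0, int n)}"]) (auto simp: int_affine_def)

lemma coord_fun_mem: "coord_fun i \<in> mcnaughton_pos"
  unfolding coord_fun_def
proof (rule mcnaughton_posI[of "{(axis i 1, 0)}"])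
  show "\<exists>l\<in>{(axis i 1, 0)}. p $ i = int_affine l p" for p :: "real ^ 'a"
    by (simp add: int_affine_def axis_def if_distrib if_distribR cong: if_cong)
qed (auto simp: unit_cube_def mem_box_cart intro: continuous_intros)

lemma const_fun_mem_01: "const_fun 0 \<in> mcnaughton_pos" "const_fun 1 \<in> mcnaughton_pos"
  using const_fun_mem[of 0] const_fun_mem[of 1] by simp_all

lemma scale_mem:
  assumes "f \<in> mcnaughton_pos"
  shows "(\<lambda>p\<in>unit_cube. real n * f p) \<in> mcnaughton_pos"
proof (induction n)
  case 0
  then show ?case using const_fun_mem_01(1) by (simp add: const_fun_def restrict_def)
next
  case (Suc n)
  have "(\<lambda>p\<in>unit_cube. real (Suc n) * f p) = hoop_add (\<lambda>p\<in>unit_cube. real n * f p) f"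
    by (auto simp: hoop_add_def fun_eq_iff algebra_simps)
  then show ?case using hoop_add_mem[OF Suc assms] by (simp add: restrict_def)
qed

lemma sum_mem:
  assumes "finite I" "\<And>i. i \<in> I \<Longrightarrow> F i \<in> mcnaughton_pos"
  shows "(\<lambda>p\<in>unit_cube. \<Sum>i\<in>I. F i p) \<in> mcnaughton_pos"
  using assms
proof (induction I rule: finite_induct)
  case empty
  then show ?case using const_fun_mem_01(1) by (simp add: const_fun_def restrict_def)
next
  case (insert i I)
  have "(\<lambda>p\<in>unit_cube. \<Sum>i\<in>insert i I. F i p) = hoop_add (F i) (\<lambda>p\<in>unit_cube. \<Sum>i\<in>I. F i p)"
    using insert by (auto simp: hoop_add_def fun_eq_iff)
  then show ?case using hoop_add_mem[OF insert.prems(1)[of i] insert.IH] insert by (simp add: restrict_def)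
qed

lemma mcnaughton_bounded:
  assumes "f \<in> mcnaughton_pos"
  obtains n :: nat where "\<And>p. p \<in> unit_cube \<Longrightarrow> f p \<le> real n"
proof -
  have "compact (f ` unit_cube)"
    using mcnaughton_posD(2)[OF assms] by (intro compact_continuous_image) (auto simp: unit_cube_def)
  then obtain B where B: "\<And>x. x \<in> f ` unit_cube \<Longrightarrow> norm x \<le> B"
    using compact_imp_bounded bounded_iff by metis
  obtain n where "B \<le> real n" using real_arch_simple by blast
  then show ?thesis using B by (intro that[of n]) force
qed

lemma hoop_automorphism_inv:
  assumes "hoop_automorphism \<sigma>"
  shows "hoop_automorphism (inv_into mcnaughton_pos \<sigma>)"
proof -
  let ?t = "inv_into mcnaughton_pos \<sigma>"
  have bij: "bij_betw \<sigma> mcnaughton_pos mcnaughton_pos"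
    using assms by (simp add: hoop_automorphism_def)
  have mem: "?t f \<in> mcnaughton_pos" and st: "\<sigma> (?t f) = f" if "f \<in> mcnaughton_pos" for f
    using that bij by (auto simp: bij_betw_def f_inv_into_f inv_into_into)
  have ts: "?t (\<sigma> f) = f" if "f \<in> mcnaughton_pos" for f
    using that bij by (simp add: bij_betw_inv_into_left)
  have "?t (hoop_add f g) = hoop_add (?t f) (?t g)"
    if "f \<in> mcnaughton_pos" "g \<in> mcnaughton_pos" for f g
  proof -
    have "\<sigma> (hoop_add (?t f) (?t g)) = hoop_add f g"
      using assms that by (simp add: hoop_automorphism_def mem st)
    then show ?thesis using ts hoop_add_mem mem that by metis
  qed
  moreover have "?t (hoop_diff f g) = hoop_diff (?t f) (?t g)"
    if "f \<in> mcnaughton_pos" "g \<in> mcnaughton_pos" for f g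
  proof -
    have "\<sigma> (hoop_diff (?t f) (?t g)) = hoop_diff f g"
      using assms that by (simp add: hoop_automorphism_def mem st)
    then show ?thesis using ts hoop_diff_mem mem that by metis
  qed
  moreover have "?t (const_fun 0) = const_fun 0"
    using ts[OF const_fun_mem_01(1)] assms by (simp add: hoop_automorphism_def)
  ultimately show ?thesis
    using bij_betw_inv_into[OF bij] by (simp add: hoop_automorphism_def)
qed

section \<open>Evaluating an automorphism at a point of the cube\<close>

locale hoop_aut =
  fixes \<sigma> :: "(real ^ 'm \<Rightarrow> real) \<Rightarrow> (real ^ 'm \<Rightarrow> real)"
  assumes aut: "hoop_automorphism \<sigma>"
begin

abbreviation "f\<^sub>1 \<equiv> \<sigma> (const_fun 1)"
abbreviation "S \<equiv> dual_map \<sigma>"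

lemma image_mem: "f \<in> mcnaughton_pos \<Longrightarrow> \<sigma> f \<in> mcnaughton_pos"
  using aut by (auto simp: hoop_automorphism_def bij_betw_def)

lemma preimage:
  assumes "f \<in> mcnaughton_pos"
  obtains g where "g \<in> mcnaughton_pos" "\<sigma> g = f"
proof -
  have "f \<in> \<sigma> ` mcnaughton_pos"
    using aut assms by (simp add: hoop_automorphism_def bij_betw_def)
  then show ?thesis using that by blast
qed

lemma map_add:
  assumes "f \<in> mcnaughton_pos" "g \<in> mcnaughton_pos" "p \<in> unit_cube"
  shows "\<sigma> (hoop_add f g) p = \<sigma> f p + \<sigma> g p"
proof -
  have "\<sigma> (hoop_add f g) = hoop_add (\<sigma> f) (\<sigma> g)"
    using aut assms by (simp add: hoop_automorphism_def)
  then show ?thesis using assms by (simp add: hoop_add_def)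
qed

lemma map_diff:
  assumes "f \<in> mcnaughton_pos" "g \<in> mcnaughton_pos" "p \<in> unit_cube"
  shows "\<sigma> (hoop_diff f g) p = max 0 (\<sigma> f p - \<sigma> g p)"
proof -
  have "\<sigma> (hoop_diff f g) = hoop_diff (\<sigma> f) (\<sigma> g)"
    using aut assms by (simp add: hoop_automorphism_def)
  then show ?thesis using assms by (simp add: hoop_diff_def)
qed

lemma map_zero: "p \<in> unit_cube \<Longrightarrow> \<sigma> (const_fun 0) p = 0"
  using aut by (simp add: hoop_automorphism_def const_fun_def)

text \<open>The order of a hoop is equational: f lies below g exactly when the truncated difference
  of f and g vanishes.\<close>

lemma map_mono:
  assumes "f \<in> mcnaughton_pos" "g \<in> mcnaughton_pos" "p \<in> unit_cube"
    and "\<And>p. p \<in> unit_cube \<Longrightarrow> f p \<le> g p"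
  shows "\<sigma> f p \<le> \<sigma> g p"
proof -
  have "hoop_diff f g = const_fun 0"
    using assms(4) by (auto simp: hoop_diff_def const_fun_def fun_eq_iff)
  then have "max 0 (\<sigma> f p - \<sigma> g p) = 0"
    using map_diff[OF assms(1-3)] map_zero assms(3) by simp
  then show ?thesis by linarith
qed

lemma map_scale:
  assumes "f \<in> mcnaughton_pos" "p \<in> unit_cube"
  shows "\<sigma> (\<lambda>p\<in>unit_cube. real n * f p) p = real n * \<sigma> f p"
proof (induction n)
  case 0
  then show ?case using map_zero[OF assms(2)] by (simp add: const_fun_def restrict_def)
next
  case (Suc n)
  have "(\<lambda>p\<in>unit_cube. real (Suc n) * f p) = hoop_add (\<lambda>p\<in>unit_cube. real n * f p) f"
    by (auto simp: hoop_add_def fun_eq_iff algebra_simps)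
  then show ?case
    using map_add[OF scale_mem[OF assms(1), of n] assms(1,2)] Suc by (simp add: restrict_def algebra_simps)
qed

lemma map_const:
  assumes "p \<in> unit_cube"
  shows "\<sigma> (const_fun (real n)) p = real n * f\<^sub>1 p"
proof -
  have "const_fun (real n) = (\<lambda>p\<in>unit_cube. real n * const_fun 1 (p :: real ^ 'm))"
    by (auto simp: const_fun_def)
  then show ?thesis using map_scale[OF const_fun_mem_01(2) assms] by simp
qed

lemma map_sum:
  assumes "finite I" "\<And>i. i \<in> I \<Longrightarrow> F i \<in> mcnaughton_pos" "p \<in> unit_cube"
  shows "\<sigma> (\<lambda>p\<in>unit_cube. \<Sum>i\<in>I. F i p) p = (\<Sum>i\<in>I. \<sigma> (F i) p)"
  using assms
proof (induction I rule: finite_induct)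
  case empty
  then show ?case using map_zero[OF assms(3)] by (simp add: const_fun_def restrict_def)
next
  case (insert i I)
  have "(\<lambda>p\<in>unit_cube. \<Sum>i\<in>insert i I. F i p) = hoop_add (F i) (\<lambda>p\<in>unit_cube. \<Sum>i\<in>I. F i p)"
    using insert by (auto simp: hoop_add_def fun_eq_iff)
  then show ?case
    using map_add[OF _ sum_mem[of I F], of "F i" p] insert by (simp add: restrict_def)
qed

text \<open>The constant 1 is a strong unit. By surjectivity it equals \<open>\<sigma> g\<close> for
  some g, and g is bounded by some n; applying \<open>\<sigma>\<close> to this bound gives 1 \<le> n
  \<open>f\<^sub>1 p\<close>.\<close>

lemma unit_pos:
  assumes "p \<in> unit_cube"
  shows "0 < f\<^sub>1 p"
proof -
  obtain g where g: "g \<in> mcnaughton_pos" "\<sigma> g = const_fun 1"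
    using preimage[OF const_fun_mem_01(2)] by blast
  obtain n where "\<And>p. p \<in> unit_cube \<Longrightarrow> g p \<le> real n"
    using mcnaughton_bounded[OF g(1)] by blast
  then have "\<sigma> g p \<le> \<sigma> (const_fun (real n)) p"
    using g assms by (intro map_mono const_fun_mem) (auto simp: const_fun_def)
  then have "1 \<le> real n * f\<^sub>1 p"
    using assms by (simp add: map_const g(2)) (simp add: const_fun_def)
  moreover have "0 \<le> f\<^sub>1 p"
    using mcnaughton_posD(3)[OF image_mem[OF const_fun_mem_01(2)] assms] .
  ultimately show ?thesis by (cases "f\<^sub>1 p = 0") auto
qed

lemma map_coord: "p \<in> unit_cube \<Longrightarrow> \<sigma> (coord_fun i) p = f\<^sub>1 p * S p $ i"
  using unit_pos[of p] by (simp add: dual_map_def)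

lemma dual_map_in_cube:
  assumes "p \<in> unit_cube"
  shows "S p \<in> unit_cube"
proof -
  have "0 \<le> \<sigma> (coord_fun i) p" for i
    using mcnaughton_posD(3)[OF image_mem[OF coord_fun_mem] assms] .
  moreover have "\<sigma> (coord_fun i) p \<le> f\<^sub>1 p" for i
    using assms
    by (intro map_mono coord_fun_mem const_fun_mem_01)
       (auto simp: coord_fun_def const_fun_def unit_cube_def mem_box_cart)
  ultimately show ?thesis
    using unit_pos[OF assms] by (simp add: dual_map_def unit_cube_def mem_box_cart)
qed

text \<open>Continuity of \<open>g\<close> at \<open>q = S p\<close> squeezes \<open>b g\<close> between integer combinations of the
  functions \<open>\<bar>b x\<^sub>i - \<lfloor>b q\<^sub>i\<rfloor>\<bar>\<close> and \<open>1\<close>, up to an error that is small compared with \<open>b\<close>; \<open>\<sigma>\<close>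
  preserves these combinations and the order.\<close>

lemma map_eq_dual:
  assumes g: "g \<in> mcnaughton_pos" and p: "p \<in> unit_cube"
  shows "\<sigma> g p = f\<^sub>1 p * g (S p)"
proof -
  define c where "c = f\<^sub>1 p"
  define q where "q = S p"
  define m where "m = CARD('m)"
  have c: "0 < c" and q: "q \<in> unit_cube"
    using unit_pos[OF p] dual_map_in_cube[OF p] by (auto simp: c_def q_def)
  have q01: "0 \<le> q $ i" for i
    using q by (simp add: unit_cube_def mem_box_cart)
  have "\<bar>\<sigma> g p - c * g q\<bar> \<le> 2 * c / real (Suc e0)" for e0
  proof -
    define e where "e = Suc e0"
    have e: "e > 0" by (simp add: e_def)
    obtain d where d: "d > 0" "\<And>x. x \<in> unit_cube \<Longrightarrow> dist x q < d \<Longrightarrow> dist (g x) (g q) < 1 / real e"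
      using mcnaughton_posD(2)[OF g] q e unfolding continuous_on_iff
      by (metis of_nat_0_less_iff zero_less_divide_1_iff)
    obtain M where M: "\<And>x. x \<in> unit_cube \<Longrightarrow> g x \<le> real M"
      using mcnaughton_bounded[OF g] by blast
    obtain K :: nat where "real M / d \<le> real K" using real_arch_simple by blast
    then have K: "real M \<le> real K * d" using d by (simp add: field_simps)
    \<comment> \<open>Within distance d of q continuity alone gives the bound; farther away the
      slope K, at least M / d, already exceeds the whole range [0, M] of g.\<close>
    have near: "\<bar>g x - g q\<bar> \<le> 1 / real e + real K * (\<Sum>i\<in>UNIV. \<bar>x $ i - q $ i\<bar>)"
      if x: "x \<in> unit_cube" for x
    proof (cases "dist x q < d")
      case True
      have "0 \<le> real K * (\<Sum>i\<in>UNIV. \<bar>x $ i - q $ i\<bar>)" by (simp add: sum_nonneg)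
      then show ?thesis using d(2)[OF x True] unfolding dist_real_def by linarith
    next
      case False
      have "\<bar>g x - g q\<bar> \<le> real M"
        using M[OF x] M[OF q] mcnaughton_posD(3)[OF g x] mcnaughton_posD(3)[OF g q] by linarith
      also have "\<dots> \<le> real K * dist x q"
        using K False by (smt (verit) mult_left_mono of_nat_0_le_iff)
      also have "\<dots> \<le> real K * (\<Sum>i\<in>UNIV. \<bar>x $ i - q $ i\<bar>)"
        using norm_le_l1_cart[of "x - q"] by (intro mult_left_mono) (auto simp: dist_norm)
      finally show ?thesis by (simp add: add_increasing)
    qed
    \<comment> \<open>The rounding errors are 1 for \<open>N\<close>, K m for replacing each b q_i
      by the integer \<open>a i\<close>, and another K m for the value of \<open>\<sigma> h\<close>
      at p; they add up to t. Since b = e t, the tolerance b / e left by continuity is also t. The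
      total 2 t becomes 2 / e after division by b.\<close>
    define t where "t = 1 + 2 * K * m"
    define b where "b = e * t"
    define a where "a i = nat \<lfloor>real b * q $ i\<rfloor>" for i
    define N where "N = nat \<lfloor>real b * g q\<rfloor>"
    have t: "t > 0" and b: "b > 0" using e by (simp_all add: t_def b_def)
    have a_near: "\<bar>real b * q $ i - real (a i)\<bar> \<le> 1" for i
    proof -
      have "0 \<le> real b * q $ i" using q01 by simp
      then show ?thesis unfolding a_def by linarith
    qed
    have "0 \<le> real b * g q" using mcnaughton_posD(3)[OF g q] by simp
    then have N: "real N \<le> real b * g q" "real b * g q \<le> real N + 1"
      unfolding N_def by linarith+
    define bx where "bx i = (\<lambda>x\<in>unit_cube. real b * coord_fun i (x :: real ^ 'm))" for i
    \<comment> \<open>The absolute value of b x_i - \<open>a i\<close> as a sum of two truncated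
      differences, at least one of which vanishes at each point. In this form
      \<open>\<sigma>\<close> can be computed on it.\<close>
    define D where "D i = hoop_add (hoop_diff (bx i) (const_fun (real (a i))))
        (hoop_diff (const_fun (real (a i))) (bx i))" for i
    define h where "h = (\<lambda>x\<in>unit_cube. \<Sum>i\<in>UNIV. D i x)"
    have bx_mem: "bx i \<in> mcnaughton_pos" for i
      unfolding bx_def by (intro scale_mem coord_fun_mem)
    have D_mem: "D i \<in> mcnaughton_pos" for i
      unfolding D_def by (intro hoop_add_mem hoop_diff_mem bx_mem const_fun_mem)
    have h_mem: "h \<in> mcnaughton_pos"
      unfolding h_def by (intro sum_mem D_mem) simp
    have h_eq: "h x = (\<Sum>i\<in>UNIV. \<bar>real b * x $ i - real (a i)\<bar>)" if "x \<in> unit_cube" for x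
      using that unfolding h_def D_def bx_def
      by (simp add: hoop_add_def hoop_diff_def const_fun_def coord_fun_def)
         (intro sum.cong; auto)
    have sD: "\<sigma> (D i) p \<le> c" for i
    proof -
      have "\<sigma> (bx i) p = real b * (c * q $ i)"
        unfolding bx_def using map_scale[OF coord_fun_mem p] map_coord[OF p]
        by (simp add: c_def q_def)
      then have "\<sigma> (D i) p = \<bar>c * (real b * q $ i - real (a i))\<bar>"
        unfolding D_def using p
        by (simp add: map_add map_diff hoop_diff_mem bx_mem const_fun_mem map_const c_def[symmetric])
           (auto simp: algebra_simps)
      also have "\<dots> \<le> c * 1"
        unfolding abs_mult using c a_near[of i] by (intro mult_mono) auto
      finally show ?thesis by simp
    qed
    have "\<sigma> h p = (\<Sum>i\<in>UNIV. \<sigma> (D i) p)"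
      unfolding h_def by (intro map_sum D_mem p) simp
    also have "\<dots> \<le> real m * c"
      using sum_mono[of UNIV "\<lambda>i. \<sigma> (D i) p" "\<lambda>i. c"] sD by (simp add: m_def)
    finally have sh: "real K * \<sigma> h p \<le> real K * (real m * c)"
      by (intro mult_left_mono) auto
    have sum_near: "real b * \<bar>g x - g q\<bar> \<le> real t + real K * h x + real K * real m"
      if x: "x \<in> unit_cube" for x
    proof -
      have "real b * (\<Sum>i\<in>UNIV. \<bar>x $ i - q $ i\<bar>) = (\<Sum>i\<in>UNIV. \<bar>real b * x $ i - real b * q $ i\<bar>)"
        by (simp add: sum_distrib_left abs_mult flip: right_diff_distrib)
      also have "\<dots> \<le> (\<Sum>i\<in>UNIV. \<bar>real b * x $ i - real (a i)\<bar> + 1)"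
        using a_near by (intro sum_mono) (smt (verit))
      also have "\<dots> = h x + real m"
        by (simp add: h_eq[OF x] sum.distrib m_def)
      finally have *: "real K * (real b * (\<Sum>i\<in>UNIV. \<bar>x $ i - q $ i\<bar>)) \<le> real K * (h x + real m)"
        by (intro mult_left_mono) auto
      have "real b * \<bar>g x - g q\<bar> \<le> real b * (1 / real e + real K * (\<Sum>i\<in>UNIV. \<bar>x $ i - q $ i\<bar>))"
        using near[OF x] by (intro mult_left_mono) auto
      also have "\<dots> = real t + real K * (real b * (\<Sum>i\<in>UNIV. \<bar>x $ i - q $ i\<bar>))"
        using e by (simp add: b_def field_simps)
      finally show ?thesis using * by (simp add: algebra_simps)
    qed
    define bg where "bg = (\<lambda>x\<in>unit_cube. real b * g x)"
    define Kh where "Kh = (\<lambda>x\<in>unit_cube. real K * h x)"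
    have bg: "bg \<in> mcnaughton_pos" "\<sigma> bg p = real b * \<sigma> g p"
      unfolding bg_def using scale_mem[OF g] map_scale[OF g p] by auto
    have Kh: "Kh \<in> mcnaughton_pos" "\<sigma> Kh p = real K * \<sigma> h p"
      unfolding Kh_def using scale_mem[OF h_mem] map_scale[OF h_mem p] by auto
    have split: "real b * \<bar>g x - g q\<bar> = \<bar>real b * g x - real b * g q\<bar>" for x
      by (simp add: abs_mult flip: right_diff_distrib)
    have "\<sigma> bg p \<le> \<sigma> (hoop_add (const_fun (real (N + 1 + t + K * m))) Kh) p"
    proof (intro map_mono bg p hoop_add_mem const_fun_mem Kh)
      fix x :: "real ^ 'm" assume x: "x \<in> unit_cube"
      have "real b * g x \<le> real (N + 1 + t + K * m) + real K * h x"
        using sum_near[OF x] N(2) split[of x] by simp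
      then show "bg x \<le> hoop_add (const_fun (real (N + 1 + t + K * m))) Kh x"
        unfolding bg_def Kh_def hoop_add_def const_fun_def using x by simp
    qed
    also have "\<dots> = real (N + 1 + t + K * m) * c + real K * \<sigma> h p"
      using map_add[OF const_fun_mem Kh(1) p] map_const[OF p] Kh(2) unfolding c_def by metis
    finally have "real b * \<sigma> g p \<le> real (N + 1 + t + K * m) * c + real K * (real m * c)"
      using bg sh by linarith
    also have "\<dots> = (real N + 2 * real t) * c"
      by (simp add: t_def algebra_simps)
    also have "\<dots> \<le> (real b * g q + 2 * real t) * c"
      using N(1) c by (intro mult_right_mono) auto
    finally have upper: "real b * \<sigma> g p \<le> (real b * g q + 2 * real t) * c" .
    have "\<sigma> (const_fun (real N)) p \<le> \<sigma> (hoop_add bg (hoop_add (const_fun (real (t + K * m))) Kh)) p"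
    proof (intro map_mono bg p hoop_add_mem const_fun_mem Kh)
      fix x :: "real ^ 'm" assume x: "x \<in> unit_cube"
      have "real N \<le> real b * g x + (real (t + K * m) + real K * h x)"
        using sum_near[OF x] N(1) split[of x] by simp
      then show "const_fun (real N) x \<le> hoop_add bg (hoop_add (const_fun (real (t + K * m))) Kh) x"
        unfolding bg_def Kh_def hoop_add_def const_fun_def using x by simp
    qed
    also have "\<dots> = real b * \<sigma> g p + (real (t + K * m) * c + real K * \<sigma> h p)"
      using map_add[OF bg(1) hoop_add_mem[OF const_fun_mem Kh(1)] p]
        map_add[OF const_fun_mem Kh(1) p] map_const[OF p] Kh(2) bg(2) unfolding c_def by metis
    finally have "real N * c \<le> real b * \<sigma> g p + (real (t + K * m) * c + real K * (real m * c))"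
      using map_const[OF p, of N] sh unfolding c_def by linarith
    moreover have "(real b * g q - 1) * c \<le> real N * c"
      using N(2) c by (intro mult_right_mono) auto
    moreover have "real (t + K * m) * c + real K * (real m * c) = (2 * real t - 1) * c"
      by (simp add: t_def algebra_simps)
    ultimately have "(real b * g q - 2 * real t) * c \<le> real b * \<sigma> g p"
      by (simp add: algebra_simps)
    with upper have "\<bar>real b * (\<sigma> g p - c * g q)\<bar> \<le> 2 * real t * c"
      by (simp add: algebra_simps abs_le_iff)
    then have "real t * (real e * \<bar>\<sigma> g p - c * g q\<bar>) \<le> real t * (2 * c)"
      by (simp only: abs_mult b_def of_nat_mult abs_of_nat mult_ac)
    then have "real e * \<bar>\<sigma> g p - c * g q\<bar> \<le> 2 * c"
      using t by simp
    then show ?thesis using e unfolding e_def by (simp add: field_simps)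
  qed
  moreover have "(\<lambda>n. 2 * c / real (Suc n)) \<longlonglongrightarrow> 0"
    using LIMSEQ_Suc[OF lim_const_over_n[of "2 * c"]] by simp
  ultimately have "\<bar>\<sigma> g p - c * g q\<bar> \<le> 0"
    by (intro LIMSEQ_le_const) auto
  then show ?thesis by (simp add: c_def q_def)
qed

end

subsection \<open>Denominators\<close>

lemma homogeneous_nth [simp]: "homogeneous p $ None = 1" "homogeneous p $ Some i = p $ i"
  by (simp_all add: homogeneous_def)

abbreviation real_vec :: "int ^ 'n \<Rightarrow> real ^ 'n" where
  "real_vec v \<equiv> (\<chi> j. of_int (v $ j))"

text \<open>Two integral vectors v and a on the same ray satisfy v_n a = a_n v. If both are
  primitive, comparing Gcds and using positive last entries gives v_n = a_n, so the description in
  \<open>primitive_coords\<close> has only one solution.\<close>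

lemma primitive_coords_eq:
  fixes v :: "int ^ ('m::finite) option"
  assumes "t > 0" "real_vec v = t *\<^sub>R homogeneous p" "Gcd (range (($) v)) = 1"
  shows "primitive_coords p = v"
  unfolding primitive_coords_def
proof (rule the_equality)
  show "(\<exists>c>0. real_vec v = c *\<^sub>R homogeneous p) \<and> Gcd (range (($) v)) = 1"
    using assms by blast
  fix a :: "int ^ 'm option"
  assume "(\<exists>c>0. real_vec a = c *\<^sub>R homogeneous p) \<and> Gcd (range (($) a)) = 1"
  then obtain c where c: "c > 0" "real_vec a = c *\<^sub>R homogeneous p" and a: "Gcd (range (($) a)) = 1"
    by blast
  have vj: "of_int (v $ j) = t * homogeneous p $ j" and aj: "of_int (a $ j) = c * homogeneous p $ j" for j
    using assms(2) c(2) by (simp_all add: vec_eq_iff)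
  have t: "t = of_int (v $ None)" and c': "c = of_int (a $ None)"
    using vj[of None] aj[of None] by simp_all
  have cross: "v $ None * a $ j = a $ None * v $ j" for j
  proof -
    have "real_of_int (v $ None * a $ j) = real_of_int (a $ None * v $ j)"
      unfolding of_int_mult t[symmetric] c'[symmetric] vj aj by simp
    then show ?thesis by linarith
  qed
  have "(*) (v $ None) ` range (($) a) = (*) (a $ None) ` range (($) v)"
    by (simp add: image_image cross)
  then have "Gcd ((*) (v $ None) ` range (($) a)) = Gcd ((*) (a $ None) ` range (($) v))"
    by (rule arg_cong)
  then have "normalize (v $ None) = normalize (a $ None)"
    unfolding Gcd_mult a assms(3) by simp
  moreover have "v $ None > 0" "a $ None > 0"
    using assms(1) c(1) t c' by simp_all
  ultimately have eq: "a $ None = v $ None" by simp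
  have "a $ j = v $ j" for j
    using cross[of j] \<open>v $ None > 0\<close> unfolding eq by simp
  then show "a = v" by (simp add: vec_eq_iff)
qed

text \<open>Dividing an integral vector on the ray by its Gcd leaves a primitive vector on the same
  ray, which by uniqueness is the one selected by \<open>primitive_coords\<close>.\<close>

lemma primitive_coords_of_int_multiple:
  fixes v :: "int ^ ('m::finite) option"
  assumes "t > 0" "real_vec v = t *\<^sub>R homogeneous p"
  shows "Gcd (range (($) v)) > 0"
    and "v $ j = Gcd (range (($) v)) * primitive_coords p $ j"
    and "Gcd (range (($) (primitive_coords p))) = 1"
proof -
  let ?k = "Gcd (range (($) v))"
  have "of_int (v $ None) = t" using assms(2) by (simp add: vec_eq_iff)
  then have "v $ None > 0" using assms(1) by simp
  then have k: "?k > 0"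
    by (metis Gcd_0_iff Gcd_int_greater_eq_0 less_le rangeI singletonD subsetD less_irrefl)
  then show "?k > 0" .
  define w where "w = (\<chi> j. v $ j div ?k)"
  have v: "v $ j = ?k * w $ j" for j
    by (simp add: w_def)
  have "range (($) v) = (*) ?k ` range (($) w)"
    unfolding image_image by (rule image_cong[OF refl v])
  then have "?k = Gcd ((*) ?k ` range (($) w))"
    by (rule arg_cong)
  also have "\<dots> = ?k * Gcd (range (($) w))"
    unfolding Gcd_mult using k by (simp add: abs_mult)
  finally have w1: "Gcd (range (($) w)) = 1"
    using k by (metis less_irrefl mult_cancel_left1)
  obtain K where K: "K = real_of_int ?k" by blast
  have K0: "K > 0" unfolding K using k by (simp only: of_int_0_less_iff)
  have "K * of_int (w $ j) = t * homogeneous p $ j" for j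
    unfolding K of_int_mult[symmetric] v[symmetric] using assms(2) by (simp add: vec_eq_iff)
  then have "real_vec w = (t / K) *\<^sub>R homogeneous p"
    using K0 by (simp add: vec_eq_iff field_simps)
  then have "primitive_coords p = w"
    using w1 K0 assms(1) by (intro primitive_coords_eq[of "t / K"]) auto
  then show "v $ j = ?k * primitive_coords p $ j" "Gcd (range (($) (primitive_coords p))) = 1"
    using v[of j] w1 by (simp_all only:)
qed

lemma den_le:
  fixes v :: "int ^ ('m::finite) option"
  assumes "t > 0" "real_vec v = t *\<^sub>R homogeneous p"
  shows "den p \<le> v $ None"
proof -
  have "real_of_int (v $ None) = t" using assms(2) by (simp add: vec_eq_iff)
  then have "v $ None > 0" using assms(1) by simp
  moreover have "v $ None = Gcd (range (($) v)) * den p" "Gcd (range (($) v)) > 0"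
    unfolding den_def by (rule primitive_coords_of_int_multiple[OF assms])+
  ultimately show ?thesis
    by (smt (verit, best) mult_le_cancel_right1 zero_less_mult_pos)
qed

lemma rational_int_multiple:
  fixes p :: "real ^ 'm"
  assumes "rational_point p"
  obtains v t where "t > 0" "real_vec v = t *\<^sub>R homogeneous p"
proof -
  have "\<exists>n::int. n > 0 \<and> of_int n * p $ i \<in> \<int>" for i
  proof -
    have "p $ i \<in> \<rat>" using assms by (simp add: rational_point_def)
    then obtain a b where "b > 0" "p $ i = of_int a / of_int b"
      by (cases rule: Rats_cases') auto
    then show ?thesis by (intro exI[of _ b]) auto
  qed
  then obtain n where n: "\<And>i. n i > (0::int)" "\<And>i. of_int (n i) * p $ i \<in> \<int>" by metis
  let ?N = "\<Prod>i\<in>UNIV. n i"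
  have "of_int ?N * homogeneous p $ j \<in> \<int>" for j
  proof (cases j)
    case (Some i)
    have "?N = n i * (\<Prod>i\<in>UNIV - {i}. n i)"
      by (simp add: prod.remove)
    then have "of_int ?N * homogeneous p $ j = of_int (\<Prod>i\<in>UNIV - {i}. n i) * (of_int (n i) * p $ i)"
      using Some by simp
    then show ?thesis using n(2) by (metis Ints_mult Ints_of_int)
  qed (simp add: Ints_prod)
  then have "real_vec (\<chi> j. \<lfloor>of_int ?N * homogeneous p $ j\<rfloor>) = of_int ?N *\<^sub>R homogeneous p"
    by (simp add: vec_eq_iff)
  moreover have "?N > 0" using n(1) by (simp add: prod_pos)
  ultimately show ?thesis using that by (metis of_int_0_less_iff)
qed

lemma primitive_coords:
  fixes p :: "real ^ 'm"
  assumes "rational_point p"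
  shows "den p > 0" "of_int (primitive_coords p $ j) = of_int (den p) * homogeneous p $ j"
    and "Gcd (range (($) (primitive_coords p))) = 1"
proof -
  obtain v t where v: "t > 0" "real_vec v = t *\<^sub>R homogeneous p"
    using rational_int_multiple[OF assms] by blast
  let ?k = "Gcd (range (($) v))"
  note * = primitive_coords_of_int_multiple[OF v]
  have k: "of_int ?k * of_int (primitive_coords p $ j) = t * homogeneous p $ j" for j
    unfolding of_int_mult[symmetric] *(2)[of j, symmetric] using v(2) by (simp add: vec_eq_iff)
  have t: "t = of_int ?k * of_int (den p)" using k[of None] by (simp add: den_def)
  then have "0 < ?k * den p" using v(1) by (metis of_int_0_less_iff of_int_mult)
  then show "den p > 0" using *(1) by (simp add: zero_less_mult_iff)
  show "of_int (primitive_coords p $ j) = of_int (den p) * homogeneous p $ j"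
    using k[of j] *(1) unfolding t mult.assoc by (metis less_irrefl mult_left_cancel of_int_eq_0_iff)
  show "Gcd (range (($) (primitive_coords p))) = 1" by (rule *(3))
qed

lemma rational_point_of_int_multiple:
  fixes p :: "real ^ 'm"
  assumes "t > 0" "real_vec v = t *\<^sub>R homogeneous p"
  shows "rational_point p"
  unfolding rational_point_def
proof
  fix i
  have *: "real_of_int (v $ j) = t * homogeneous p $ j" for j
    using assms(2) by (simp add: vec_eq_iff)
  have "p $ i = of_int (v $ Some i) / of_int (v $ None)"
    using *[of None] *[of "Some i"] assms(1) by simp
  then show "p $ i \<in> \<rat>" by simp
qed

section \<open>Unimodular matrices and primitive vectors\<close>

lemma cramer_int:
  fixes A :: "int ^ 'n ^ 'n"
  shows "det (\<chi> i j. if j = k then (A *v x) $ i else A $ i $ j) = x $ k * det A"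
proof -
  let ?B = "\<chi> i j. if j = k then (A *v x) $ i else A $ i $ j"
  let ?A = "map_matrix of_int A :: real ^ 'n ^ 'n"
  \<comment> \<open>Cramer's rule is borrowed from the reals: \<open>of_int\<close> is injective and
    commutes with determinants.\<close>
  have "(map_matrix of_int ?B :: real ^ 'n ^ 'n)
      = (\<chi> i j. if j = k then (?A *v real_vec x) $ i else ?A $ i $ j)"
    by (simp add: vec_eq_iff matrix_vector_mult_def)
  then have "det (map_matrix of_int ?B :: real ^ 'n ^ 'n) = of_int (x $ k) * det ?A"
    using cramer_lemma[of k ?A "real_vec x"] by simp
  then show ?thesis
    unfolding det_map_matrix_of_int of_int_mult[symmetric] of_int_eq_iff .
qed

text \<open>Every Leibniz summand contains exactly one factor from column \<open>k\<close>.\<close>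

lemma dvd_det_column:
  fixes A :: "'a::comm_ring_1 ^ 'n ^ 'n"
  assumes "\<And>i. d dvd A $ i $ k"
  shows "d dvd det A"
  unfolding det_def
proof (intro dvd_sum dvd_mult)
  fix p :: "'n \<Rightarrow> 'n" assume "p \<in> {p. p permutes UNIV}"
  then obtain i where "p i = k" by (metis mem_Collect_eq permutes_univ)
  then have "d dvd A $ i $ p i" using assms by simp
  also have "\<dots> dvd (\<Prod>i\<in>UNIV. A $ i $ p i)" by (intro dvd_prodI) auto
  finally show "d dvd (\<Prod>i\<in>UNIV. A $ i $ p i)" .
qed

text \<open>Cramer's rule replaces an integral inverse: x_k is the determinant of \<open>A\<close>
  with column k replaced by \<open>A *v x\<close>, so a common divisor of the entries of
  \<open>A *v x\<close> divides every x_k.\<close>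

lemma Gcd_unimodular:
  fixes A :: "int ^ 'n ^ 'n"
  assumes "det A = 1" "Gcd (range (($) x)) = 1"
  shows "Gcd (range (($) (A *v x))) = 1"
proof -
  let ?d = "Gcd (range (($) (A *v x)))"
  have "?d dvd x $ k" for k
  proof -
    have "?d dvd det (\<chi> i j. if j = k then (A *v x) $ i else A $ i $ j)"
      by (rule dvd_det_column[where k = k]) (simp add: Gcd_dvd)
    then show ?thesis by (simp add: cramer_int assms(1))
  qed
  then have "?d dvd Gcd (range (($) x))" by (intro Gcd_greatest) auto
  then show ?thesis using assms(2) by simp
qed

text \<open>The image of the primitive vector of \<open>p\<close> is primitive and lies on the ray
  of \<open>q\<close>, so it is the primitive vector of \<open>q\<close>. Comparing last entries
  identifies the proportionality factor \<open>c\<close> as a quotient of denominators.\<close>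

lemma den_unimodular:
  fixes A :: "int ^ ('m::finite) option ^ 'm option"
  assumes A: "det A = 1" and p: "rational_point p"
    and c: "c > 0" "map_matrix of_int A *v homogeneous p = c *\<^sub>R homogeneous q"
  shows "of_int (den q) = of_int (den p) * c"
proof -
  let ?v = "A *v primitive_coords p"
  have "real_of_int (?v $ j) = of_int (den p) * (map_matrix of_int A *v homogeneous p) $ j" for j
    using primitive_coords(2)[OF p]
    by (simp add: matrix_vector_mult_def sum_distrib_left mult_ac)
  then have v: "real_vec ?v = (of_int (den p) * c) *\<^sub>R homogeneous q"
    unfolding c(2) by (simp add: vec_eq_iff)
  then have "primitive_coords q = ?v"
    using primitive_coords[OF p] c(1) by (intro primitive_coords_eq[OF _ v] Gcd_unimodular A) auto
  then show ?thesis using v by (simp add: den_def vec_eq_iff)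
qed

text \<open>The affine piece active at \<open>p\<close>, multiplied by \<open>den p\<close>, is an
  integer combination of the primitive coordinates of \<open>p\<close>.\<close>

lemma mcnaughton_den_Ints:
  assumes f: "f \<in> mcnaughton_pos" and p: "p \<in> unit_cube" "rational_point p"
  shows "of_int (den p) * f p \<in> \<int>"
proof -
  obtain a b where "f p = int_affine (a, b) p"
    using f p(1) by (auto simp: mcnaughton_pos_def mcnaughton_iff)
  then have "of_int (den p) * f p
      = (\<Sum>i\<in>UNIV. of_int (a $ i) * (of_int (den p) * p $ i)) + of_int (den p) * of_int b"
    by (simp add: int_affine_def algebra_simps sum_distrib_left)
  moreover have "of_int (den p) * p $ i \<in> \<int>" for i
    using primitive_coords(2)[OF p(2), of "Some i"] by (metis Ints_of_int homogeneous_nth(2))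
  ultimately show ?thesis by (simp add: Ints_sum Ints_mult Ints_add)
qed

lemma mcnaughton_unit_iff:
  "f \<in> mcnaughton_unit \<longleftrightarrow> f \<in> mcnaughton_pos \<and> (\<forall>p\<in>unit_cube. f p \<le> const_fun 1 p)"
  by (auto simp: mcnaughton_unit_def mcnaughton_pos_def const_fun_def)

section \<open>The inverse automorphism, exact denominators and condition (a)\<close>

context hoop_aut
begin

text \<open>Duality is contravariant, so a right inverse \<open>\<rho>\<close> of
  \<open>\<sigma>\<close> yields a left inverse of \<open>S\<close>. The representation of
  \<open>\<sigma> (\<rho> f)\<close> reads f p = \<open>f\<^sub>1 p * \<rho> f (S p)\<close>: the
  constant 1 gives the first claim, and the coordinate functions, divided by it, give the second.
  Keeping \<open>\<rho>\<close> general lets the roles of \<open>\<sigma>\<close> and its inverse be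
  exchanged.\<close>

lemma dual_map_left_inverse:
  assumes "hoop_automorphism \<rho>" "\<And>f. f \<in> mcnaughton_pos \<Longrightarrow> \<sigma> (\<rho> f) = f" and p: "p \<in> unit_cube"
  shows "f\<^sub>1 p * \<rho> (const_fun 1) (S p) = 1" "dual_map \<rho> (S p) = p"
proof -
  interpret tau: hoop_aut \<rho> by standard (rule assms(1))
  have *: "f\<^sub>1 p * \<rho> f (S p) = f p" if "f \<in> mcnaughton_pos" for f
    using map_eq_dual[OF tau.image_mem p] assms(2) that by metis
  show one: "f\<^sub>1 p * \<rho> (const_fun 1) (S p) = 1"
    using *[OF const_fun_mem_01(2)] p by (simp add: const_fun_def)
  have "\<rho> (coord_fun i) (S p) = p $ i * \<rho> (const_fun 1) (S p)" for i
  proof -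
    have "coord_fun i p = p $ i" using p by (simp add: coord_fun_def)
    then have "f\<^sub>1 p * \<rho> (coord_fun i) (S p) = p $ i" using *[OF coord_fun_mem, of i] by simp
    then have "p $ i * \<rho> (const_fun 1) (S p)
        = (f\<^sub>1 p * \<rho> (const_fun 1) (S p)) * \<rho> (coord_fun i) (S p)"
      by (simp only: mult_ac flip: \<open>f\<^sub>1 p * \<rho> (coord_fun i) (S p) = p $ i\<close>)
    then show ?thesis by (simp only: one mult_1_left)
  qed
  moreover have "\<rho> (const_fun 1) (S p) \<noteq> 0" using one by auto
  ultimately show "dual_map \<rho> (S p) = p"
    by (simp add: dual_map_def vec_eq_iff)
qed

abbreviation "\<tau> \<equiv> inv_into mcnaughton_pos \<sigma>"

lemma map_inverse: "f \<in> mcnaughton_pos \<Longrightarrow> \<sigma> (\<tau> f) = f"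
  using aut bij_betw_inv_into_right[of \<sigma> mcnaughton_pos mcnaughton_pos f]
  by (simp add: hoop_automorphism_def)

lemma inverse_map: "f \<in> mcnaughton_pos \<Longrightarrow> \<tau> (\<sigma> f) = f"
  using aut bij_betw_inv_into_left[of \<sigma> mcnaughton_pos mcnaughton_pos f]
  by (simp add: hoop_automorphism_def)

lemma bij_betw_dual_map: "bij_betw S unit_cube unit_cube"
proof -
  note t = hoop_automorphism_inv[OF aut] map_inverse inverse_map
  interpret tau: hoop_aut \<tau> by standard (rule t(1))
  show ?thesis
    by (rule bij_betwI[where g = tau.S])
       (use dual_map_in_cube tau.dual_map_in_cube dual_map_left_inverse(2)[OF t(1,2)]
         tau.dual_map_left_inverse(2)[OF aut t(3)] in auto)
qed

lemma den_dual_map_le: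
  assumes p: "p \<in> unit_cube" "rational_point p"
  shows "rational_point (S p)" "of_int (den (S p)) \<le> of_int (den p) * f\<^sub>1 p"
proof -
  define v where "v = (\<chi> j. \<lfloor>of_int (den p) * f\<^sub>1 p * homogeneous (S p) $ j\<rfloor>)"
  have "of_int (den p) * f\<^sub>1 p * homogeneous (S p) $ j \<in> \<int>" for j
  proof (cases j)
    case None
    then show ?thesis
      using mcnaughton_den_Ints[OF image_mem[OF const_fun_mem_01(2)] p] by simp
  next
    case (Some i)
    then show ?thesis
      using mcnaughton_den_Ints[OF image_mem[OF coord_fun_mem] p, of i] map_coord[OF p(1), of i]
      by (simp add: mult.assoc)
  qed
  then have v: "real_vec v = (of_int (den p) * f\<^sub>1 p) *\<^sub>R homogeneous (S p)"
    by (simp add: v_def vec_eq_iff)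
  have pos: "0 < of_int (den p) * f\<^sub>1 p"
    using primitive_coords(1)[OF p(2)] unit_pos[OF p(1)] by simp
  show "rational_point (S p)" by (rule rational_point_of_int_multiple[OF pos v])
  have "real_of_int (v $ None) = of_int (den p) * f\<^sub>1 p"
    using v by (simp add: vec_eq_iff)
  then show "of_int (den (S p)) \<le> of_int (den p) * f\<^sub>1 p"
    using den_le[OF pos v] by (metis of_int_le_iff)
qed

text \<open>Both \<open>\<sigma>\<close> and its inverse bound the denominator, so the bound is attained.\<close>

lemma den_dual_map:
  assumes p: "p \<in> unit_cube" "rational_point p"
  shows "of_int (den (S p)) = of_int (den p) * f\<^sub>1 p"
proof -
  note t = hoop_automorphism_inv[OF aut] map_inverse inverse_map
  interpret tau: hoop_aut \<tau> by standard (rule t(1))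
  have "of_int (den p) \<le> of_int (den (S p)) * \<tau> (const_fun 1) (S p)"
    using tau.den_dual_map_le(2)[OF dual_map_in_cube[OF p(1)] den_dual_map_le(1)[OF p]]
      dual_map_left_inverse(2)[OF t(1,2) p(1)] by simp
  then have "of_int (den p) * f\<^sub>1 p \<le> of_int (den (S p)) * \<tau> (const_fun 1) (S p) * f\<^sub>1 p"
    using unit_pos[OF p(1)] by (simp add: mult_right_mono)
  also have "\<dots> = of_int (den (S p))"
    using dual_map_left_inverse(1)[OF t(1,2) p(1)] by (simp add: mult_ac)
  finally show ?thesis using den_dual_map_le(2)[OF p] by simp
qed

text \<open>If \<open>f\<^sub>1\<close> is 1, the representation turns \<open>\<sigma>\<close> into
  composition with \<open>S\<close> on the cube, which respects every pointwise operation.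
  Conversely, the constant 1 is the negation of 0.\<close>

lemma mv_automorphism_iff: "f\<^sub>1 = const_fun 1 \<longleftrightarrow> restricts_to_mv_automorphism \<sigma>"
proof
  assume one: "f\<^sub>1 = const_fun 1"
  note t = hoop_automorphism_inv[OF aut] map_inverse inverse_map
  interpret tau: hoop_aut \<tau> by standard (rule t(1))
  note unit_iff = mcnaughton_unit_iff
  have tone: "\<tau> (const_fun 1) = const_fun 1"
    using t(3)[OF const_fun_mem_01(2)] unfolding one .
  have s_unit: "\<sigma> f \<in> mcnaughton_unit" if "f \<in> mcnaughton_unit" for f
    using that map_mono[OF _ const_fun_mem_01(2)] image_mem unfolding unit_iff one by blast
  have t_unit: "\<tau> f \<in> mcnaughton_unit" if "f \<in> mcnaughton_unit" for f
    using that tau.map_mono[OF _ const_fun_mem_01(2)] tau.image_mem unfolding unit_iff tone by blast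
  have dual: "\<sigma> g p = g (S p)" if "g \<in> mcnaughton_pos" "p \<in> unit_cube" for g p
  proof -
    have "f\<^sub>1 p = 1" using that(2) by (subst one) (simp add: const_fun_def)
    then show ?thesis using map_eq_dual[OF that] by simp
  qed
  have eqI: "\<sigma> f = g" if "f \<in> mcnaughton_pos" "g \<in> extensional unit_cube"
    "\<And>p. p \<in> unit_cube \<Longrightarrow> f (S p) = g p" for f g
    using that mcnaughton_posD(1)[OF image_mem[OF that(1)]]
    by (intro extensionalityI[of _ unit_cube]) (auto simp: dual)
  show "restricts_to_mv_automorphism \<sigma>"
    unfolding restricts_to_mv_automorphism_def
  proof (intro conjI ballI)
    show "bij_betw \<sigma> mcnaughton_unit mcnaughton_unit"
    proof (rule bij_betwI[where g = \<tau>])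
      show "\<sigma> \<in> mcnaughton_unit \<rightarrow> mcnaughton_unit" "\<tau> \<in> mcnaughton_unit \<rightarrow> mcnaughton_unit"
        using s_unit t_unit by blast+
      show "\<tau> (\<sigma> f) = f" "\<sigma> (\<tau> f) = f" if "f \<in> mcnaughton_unit" for f
        using that unit_iff t(2,3) by blast+
    qed
    show "\<sigma> (const_fun 0) = const_fun 0"
      using aut by (simp add: hoop_automorphism_def)
  next
    fix f g :: "real ^ 'm \<Rightarrow> real"
    assume fg: "f \<in> mcnaughton_unit" "g \<in> mcnaughton_unit"
    then have pos: "f \<in> mcnaughton_pos" "g \<in> mcnaughton_pos" by (auto simp: unit_iff)
    \<comment> \<open>Since min(1, u) is u minus the truncated difference of u and 1, the truncated
      sum stays in the cone where the representation applies.\<close>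
    have "mv_add f g = hoop_diff (hoop_add f g) (hoop_diff (hoop_add f g) (const_fun 1))"
      by (auto simp: fun_eq_iff mv_add_def hoop_diff_def hoop_add_def const_fun_def
          mcnaughton_posD(3)[OF pos(1)] mcnaughton_posD(3)[OF pos(2)] restrict_def max_def min_def)
    then have "mv_add f g \<in> mcnaughton_pos"
      using pos by (simp add: hoop_diff_mem hoop_add_mem const_fun_mem_01)
    then show "\<sigma> (mv_add f g) = mv_add (\<sigma> f) (\<sigma> g)"
      by (rule eqI) (auto simp: mv_add_def dual pos dual_map_in_cube)
  next
    fix f :: "real ^ 'm \<Rightarrow> real"
    assume f: "f \<in> mcnaughton_unit"
    then have pos: "f \<in> mcnaughton_pos" by (auto simp: unit_iff)
    have "mv_neg f = hoop_diff (const_fun 1) f"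
      using f by (auto simp: fun_eq_iff mv_neg_def hoop_diff_def const_fun_def mcnaughton_unit_def)
    then have "mv_neg f \<in> mcnaughton_pos"
      using pos by (simp add: hoop_diff_mem const_fun_mem_01)
    then show "\<sigma> (mv_neg f) = mv_neg (\<sigma> f)"
      by (rule eqI) (auto simp: mv_neg_def dual pos dual_map_in_cube)
  qed
next
  assume r: "restricts_to_mv_automorphism \<sigma>"
  have "const_fun 0 \<in> (mcnaughton_unit :: (real ^ 'm \<Rightarrow> real) set)"
    using const_fun_mem_01(1) by (auto simp: mcnaughton_unit_def mcnaughton_pos_def const_fun_def)
  then have "\<sigma> (mv_neg (const_fun 0)) = mv_neg (const_fun 0)"
    using r by (simp add: restricts_to_mv_automorphism_def)
  moreover have "mv_neg (const_fun 0) = (const_fun 1 :: real ^ 'm \<Rightarrow> real)"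
    by (auto simp: mv_neg_def const_fun_def fun_eq_iff)
  ultimately show "f\<^sub>1 = const_fun 1" by simp
qed

end

subsection \<open>Projective maps\<close>

lemma sum_UNIV_option: "(\<Sum>j\<in>UNIV. g j) = g None + (\<Sum>i\<in>UNIV. g (Some i))"
  for g :: "('m::finite) option \<Rightarrow> 'b::comm_monoid_add"
  by (simp add: UNIV_option_conv sum.reindex)

lemma matrix_vector_homogeneous:
  fixes A :: "real ^ ('m::finite) option ^ 'm option"
  shows "(A *v homogeneous q) $ i = (\<Sum>j\<in>UNIV. A $ i $ Some j * q $ j) + A $ i $ None"
  by (simp add: matrix_vector_mult_def sum_UNIV_option)

definition linear_block :: "real ^ ('m::finite) option ^ 'm option \<Rightarrow> real ^ 'm ^ 'm" where
  "linear_block A = (\<chi> i j. A $ Some i $ Some j)"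

definition translation_block :: "real ^ ('m::finite) option ^ 'm option \<Rightarrow> real ^ 'm" where
  "translation_block A = (\<chi> i. A $ Some i $ None)"

definition last_form :: "real ^ ('m::finite) option ^ 'm option \<Rightarrow> real ^ 'm" where
  "last_form A = (\<chi> j. A $ None $ Some j)"

lemma homogeneous_None_row: "(A *v homogeneous q) $ None = last_form A \<bullet> q + A $ None $ None"
  by (simp add: matrix_vector_homogeneous last_form_def inner_vec_def)

lemma homogeneous_Some_row:
  "(A *v homogeneous q) $ Some i = (linear_block A *v q + translation_block A) $ i"
  unfolding matrix_vector_homogeneous
  by (simp add: linear_block_def translation_block_def matrix_vector_mult_def)

lemma continuous_on_homogeneous_None_row:
  fixes A :: "real ^ ('m::finite) option ^ 'm option"
  shows "continuous_on X (\<lambda>q. (A *v homogeneous q) $ None)"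
  unfolding homogeneous_None_row by (intro continuous_intros)

text \<open>The action of \<open>A\<close> on rays, in the chart where the last homogeneous
  coordinate is 1. On the cells the denominator is positive by \<open>dual_map_on_cell\<close>, so
  the convention for \<open>inverse 0\<close> is never met there.\<close>

definition projective_map :: "real ^ ('m::finite) option ^ 'm option \<Rightarrow> real ^ 'm \<Rightarrow> real ^ 'm" where
  "projective_map A q = inverse (last_form A \<bullet> q + A $ None $ None) *\<^sub>R
     (linear_block A *v q + translation_block A)"

text \<open>Clearing the last column of \<open>A\<close> by unipotent row and column operations leaves the Jacobian
  matrix, up to scaling, as the upper left block.\<close>

lemma det_projective:
  fixes A :: "real ^ ('m::finite) option ^ 'm option"
  assumes l: "last_form A \<bullet> p + A $ None $ None = l" "l \<noteq> 0"
  shows "l * det (\<chi> i j. A $ Some i $ Some j - projective_map A p $ i * A $ None $ Some j) = det A"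
proof -
  let ?F = "projective_map A p"
  \<comment> \<open>Right multiplication by \<open>R\<close> replaces the last column of
    \<open>A\<close> by the image of (p, 1), which is l times (\<open>?F\<close>, 1). Then
    \<open>L\<close> subtracts \<open>?F $ i\<close> times the last row from row i and clears that
    column above its corner entry l.\<close>
  define L :: "real ^ 'm option ^ 'm option" where
    "L = (\<chi> i j. case i of None \<Rightarrow> (if j = None then 1 else 0)
       | Some i' \<Rightarrow> (case j of None \<Rightarrow> - ?F $ i' | Some j' \<Rightarrow> if i' = j' then 1 else 0))"
  define R :: "real ^ 'm option ^ 'm option" where
    "R = (\<chi> i j. case j of None \<Rightarrow> homogeneous p $ i | Some j' \<Rightarrow> if i = Some j' then 1 else 0)"
  have "det (transpose L) = 1"
    by (subst det_option_last_column)
       (auto simp: transpose_def L_def mat_def[symmetric] eq_commute)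
  moreover have "det (transpose R) = 1"
    by (subst det_option_last_column)
       (auto simp: transpose_def R_def mat_def[symmetric] eq_commute)
  ultimately have "det A = det (L ** A ** R)"
    by (simp add: det_mul)
  have LA: "(L ** A) $ None $ j = A $ None $ j"
    "(L ** A) $ Some i $ j = A $ Some i $ j - ?F $ i * A $ None $ j" for i j
    by (simp_all add: matrix_matrix_mult_def L_def sum_UNIV_option if_distrib if_distribR
        cong: if_cong)
  have B_Some: "(L ** A ** R) $ i $ Some j = (L ** A) $ i $ Some j" for i j
    by (simp add: matrix_matrix_mult_def[of "L ** A"] R_def if_distrib cong: if_cong)
  have B_None: "(L ** A ** R) $ i $ None = (\<Sum>j\<in>UNIV. (L ** A) $ i $ j * homogeneous p $ j)" for i
    by (simp add: matrix_matrix_mult_def[of "L ** A"] R_def)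
  have "(L ** A ** R) $ None $ None = (A *v homogeneous p) $ None"
    unfolding B_None LA by (simp add: matrix_vector_mult_def)
  then have nn: "(L ** A ** R) $ None $ None = l"
    using l by (simp add: homogeneous_None_row)
  have zero: "(L ** A ** R) $ Some i $ None = 0" for i
  proof -
    have "(L ** A ** R) $ Some i $ None = (A *v homogeneous p) $ Some i - ?F $ i * (A *v homogeneous p) $ None"
      unfolding B_None LA
      by (simp add: matrix_vector_mult_def sum_subtractf sum_distrib_left algebra_simps)
    then show ?thesis
      using l by (simp add: homogeneous_None_row homogeneous_Some_row projective_map_def)
  qed
  have "det (L ** A ** R) = l * det (\<chi> i j. (L ** A ** R) $ Some i $ Some j)"
    using det_option_last_column[OF zero] nn by simp
  then show ?thesis
    using \<open>det A = det (L ** A ** R)\<close> by (simp add: B_Some LA)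
qed

text \<open>The quotient rule gives the derivative \<open>D\<close> below. Its
  \<open>CARD('m)\<close> rows each release a factor 1 / l, and \<open>det_projective\<close>
  supplies one more.\<close>

lemma projective_map_derivative:
  fixes A :: "real ^ ('m::finite) option ^ 'm option"
  assumes l: "last_form A \<bullet> p + A $ None $ None = l" "l \<noteq> 0"
  shows "\<exists>D. (projective_map A has_derivative D) (at p) \<and>
    det (matrix D) = det A * inverse (l ^ (CARD('m) + 1))"
proof -
  let ?M = "linear_block A" and ?t = "translation_block A" and ?a = "last_form A"
  let ?F = "projective_map A p"
  define D where "D v = inverse l *\<^sub>R (?M *v v - (?a \<bullet> v) *\<^sub>R ?F)" for v
  have mv: "((*v) ?M has_derivative (*v) ?M) (at p)"
    by (simp add: bounded_linear_imp_has_derivative)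
  have num: "((\<lambda>q. ?M *v q + ?t) has_derivative (*v) ?M) (at p)"
    using has_derivative_add[OF mv has_derivative_const[of ?t]] by simp
  have den: "((\<lambda>q. ?a \<bullet> q + A $ None $ None) has_derivative (\<lambda>v. ?a \<bullet> v)) (at p)"
    by (auto intro!: derivative_eq_intros)
  have inv: "((\<lambda>q. inverse (?a \<bullet> q + A $ None $ None)) has_derivative
      (\<lambda>v. - (inverse l * (?a \<bullet> v) * inverse l))) (at p)"
    using Deriv.has_derivative_inverse[OF _ den] l by simp
  have "(projective_map A has_derivative
      (\<lambda>v. inverse l *\<^sub>R (?M *v v) + (- (inverse l * (?a \<bullet> v) * inverse l)) *\<^sub>R (?M *v p + ?t))) (at p)"
    unfolding projective_map_def[abs_def] using has_derivative_scaleR[OF inv num] l by simp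
  also have "(\<lambda>v. inverse l *\<^sub>R (?M *v v) + (- (inverse l * (?a \<bullet> v) * inverse l)) *\<^sub>R (?M *v p + ?t)) = D"
    using l by (simp add: D_def projective_map_def fun_eq_iff algebra_simps)
  finally have der: "(projective_map A has_derivative D) (at p)" .
  have "matrix D = (\<chi> i. inverse l *s (\<chi> j. A $ Some i $ Some j - ?F $ i * A $ None $ Some j))"
    by (simp add: matrix_def D_def matrix_vector_mult_basis column_def linear_block_def
        last_form_def inner_axis vec_eq_iff algebra_simps)
  then have "det (matrix D) = inverse l ^ CARD('m) *
      det (\<chi> i j. A $ Some i $ Some j - ?F $ i * A $ None $ Some j)"
    by (simp only: det_rows_mul prod_constant)
  also have "\<dots> = det A * inverse (l ^ (CARD('m) + 1))"
    using l(2) by (simp add: det_projective[OF l, symmetric] field_simps)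
  finally show ?thesis using der by blast
qed

text \<open>Rational points are the rational combinations of \<open>Basis\<close>, the form in which
  density in a convex set with nonempty interior is available. Boundary points of a cell are covered
  as well.\<close>

lemma closure_rational_points:
  fixes D :: "(real ^ 'm) set"
  assumes "convex D" "interior D \<noteq> {}"
  shows "closure (D \<inter> {p. rational_point p}) = closure D"
proof -
  have "(\<Union>f \<in> Basis \<rightarrow> \<rat>. {\<Sum>i :: real ^ 'm \<in> Basis. f i *\<^sub>R i}) = {p. rational_point p}"
  proof (intro equalityI subsetI)
    fix p :: "real ^ 'm"
    assume "p \<in> (\<Union>f \<in> Basis \<rightarrow> \<rat>. {\<Sum>i \<in> Basis. f i *\<^sub>R i})"
    then obtain f where f: "f \<in> Basis \<rightarrow> \<rat>" "p = (\<Sum>i \<in> Basis. f i *\<^sub>R i)" by blast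
    have "p $ j = f (axis j 1)" for j
      unfolding cart_eq_inner_axis f(2) by (intro inner_sum_left_Basis) (auto simp: axis_in_Basis_iff)
    then show "p \<in> {p. rational_point p}"
      using f(1) by (auto simp: rational_point_def axis_in_Basis_iff)
  next
    fix p :: "real ^ 'm" assume "p \<in> {p. rational_point p}"
    then have "(\<lambda>i. p \<bullet> i) \<in> Basis \<rightarrow> \<rat>"
      by (auto simp: rational_point_def Basis_vec_def inner_axis)
    moreover have "p = (\<Sum>i\<in>Basis. (p \<bullet> i) *\<^sub>R i)" by (simp add: euclidean_representation)
    ultimately show "p \<in> (\<Union>f \<in> Basis \<rightarrow> \<rat>. {\<Sum>i \<in> Basis. f i *\<^sub>R i})" by blast
  qed
  then show ?thesis using closure_rationals_in_convex_set[OF assms] by simp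
qed

lemma negligible_cell_iff:
  fixes D :: "(real ^ 'm) set"
  assumes "convex D"
  shows "negligible D \<longleftrightarrow> aff_dim D \<noteq> int CARD('m)"
proof -
  have "interior D = {} \<longleftrightarrow> aff_dim D \<noteq> int CARD('m)"
    using rel_interior_eq_empty[OF assms] aff_dim_empty[of D]
    by (auto simp: interior_rel_interior_gen)
  then show ?thesis using negligible_convex_interior[OF assms] by simp
qed

subsection \<open>Piecewise projective dual maps\<close>

locale expressed_hoop_aut = hoop_aut \<sigma>
  for \<sigma> :: "(real ^ 'm \<Rightarrow> real) \<Rightarrow> (real ^ 'm \<Rightarrow> real)" +
  fixes \<C> :: "(real ^ 'm) set set" and k :: nat and C :: "nat \<Rightarrow> (real ^ 'm) set"
    and A :: "nat \<Rightarrow> int ^ 'm option ^ 'm option"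
  assumes complex: "rational_cellular_complex \<C>"
    and support: "\<Union>\<C> = unit_cube"
    and cells: "bij_betw C {1..k} {D \<in> \<C>. aff_dim D = int CARD('m)}"
    and det_A: "\<And>h. h \<in> {1..k} \<Longrightarrow> det (A h) = 1"
    and expresses: "\<And>h. h \<in> {1..k} \<Longrightarrow> expresses_on (A h) S (C h)"
begin

abbreviation real_A :: "nat \<Rightarrow> real ^ 'm option ^ 'm option" where
  "real_A h \<equiv> map_matrix of_int (A h)"

lemma cell:
  assumes "h \<in> {1..k}"
  shows "C h \<in> \<C>" "aff_dim (C h) = int CARD('m)" "polytope (C h)" "convex (C h)" "compact (C h)"
    "C h \<subseteq> unit_cube" "interior (C h) \<noteq> {}"
proof -
  show C: "C h \<in> \<C>" "aff_dim (C h) = int CARD('m)"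
    using cells assms by (auto simp: bij_betw_def)
  show p: "polytope (C h)" using complex C by (auto simp: rational_cellular_complex_def)
  then show conv: "convex (C h)" and "compact (C h)"
    by (auto simp: polytope_imp_convex polytope_imp_compact)
  show "C h \<subseteq> unit_cube" using C support by blast
  show "interior (C h) \<noteq> {}"
    using negligible_cell_iff[OF conv] negligible_convex_interior[OF conv] C by blast
qed

text \<open>Cells of lower dimension are negligible and the union of the full-dimensional ones is
  closed. What that union misses of the interior of the cube is open and negligible, hence empty;
  taking closures reaches the boundary.\<close>

lemma cells_cover:
  assumes "p \<in> unit_cube"
  obtains h where "h \<in> {1..k}" "p \<in> C h"
proof -
  define W where "W = (\<Union>h\<in>{1..k}. C h)"
  have W: "closed W"
    unfolding W_def by (intro closed_UN ballI compact_imp_closed cell(5)) simp_all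
  let ?low = "{D \<in> \<C>. aff_dim D \<noteq> int CARD('m)}"
  have "W = \<Union>{D \<in> \<C>. aff_dim D = int CARD('m)}"
    unfolding W_def using cells by (simp add: bij_betw_def)
  then have "interior unit_cube - W \<subseteq> \<Union>?low" using support interior_subset by blast
  moreover have "negligible (\<Union>?low)"
    using complex negligible_cell_iff polytope_imp_convex
    by (intro negligible_Union) (auto simp: rational_cellular_complex_def)
  ultimately have "negligible (interior unit_cube - W)"
    by (metis negligible_subset)
  moreover have "open (interior unit_cube - W)" using W by (simp add: open_Diff)
  ultimately have "interior unit_cube \<subseteq> W"
    using open_not_negligible by blast
  then have "closure (interior unit_cube) \<subseteq> W" using W by (simp add: closure_minimal)
  moreover have "closure (interior unit_cube) = (unit_cube :: (real ^ 'm) set)"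
  proof -
    have "box 0 (1 :: real ^ 'm) \<noteq> {}"
      by (simp add: interval_ne_empty_cart)
    then show ?thesis
      unfolding unit_cube_def
      by (simp add: convex_closure_interior interior_cbox)
  qed
  ultimately show ?thesis using assms that unfolding W_def by blast
qed

text \<open>As \<open>homogeneous (S p)\<close> ends in 1, the unspecified factor in
  \<open>expresses_on\<close> can only be the last entry of the product.\<close>

lemma dual_map_on_cell:
  assumes h: "h \<in> {1..k}" and p: "p \<in> C h"
  shows "0 < (real_A h *v homogeneous p) $ None"
    and "real_A h *v homogeneous p = (real_A h *v homogeneous p) $ None *\<^sub>R homogeneous (S p)"
    and "S p = projective_map (real_A h) p"
proof -
  obtain c where c: "c > 0" "real_A h *v homogeneous p = c *\<^sub>R homogeneous (S p)"
    using expresses[OF h] p by (auto simp: expresses_on_def)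
  have "(real_A h *v homogeneous p) $ None = c" by (simp add: c)
  then show *: "0 < (real_A h *v homogeneous p) $ None"
    "real_A h *v homogeneous p = (real_A h *v homogeneous p) $ None *\<^sub>R homogeneous (S p)"
    using c by auto
  let ?l = "last_form (real_A h) \<bullet> p + real_A h $ None $ None"
  have "(linear_block (real_A h) *v p + translation_block (real_A h)) $ i = ?l * S p $ i" for i
    using arg_cong[OF *(2), of "\<lambda>v. v $ Some i"]
    unfolding homogeneous_Some_row homogeneous_None_row by simp
  then have "linear_block (real_A h) *v p + translation_block (real_A h) = ?l *\<^sub>R S p"
    by (simp add: vec_eq_iff)
  moreover have "?l \<noteq> 0" using *(1) unfolding homogeneous_None_row by simp
  ultimately show "S p = projective_map (real_A h) p"
    unfolding projective_map_def by simp
qed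

section \<open>The unit on the cells and the Jacobian determinant\<close>

lemma continuous_unit: "continuous_on unit_cube f\<^sub>1"
  by (rule mcnaughton_posD(2)[OF image_mem[OF const_fun_mem_01(2)]])

lemma unit_on_cell:
  assumes h: "h \<in> {1..k}" and p: "p \<in> C h"
  shows "f\<^sub>1 p = (real_A h *v homogeneous p) $ None"
proof -
  let ?X = "C h \<inter> {p. rational_point p}"
  let ?g = "\<lambda>q. f\<^sub>1 q - (real_A h *v homogeneous q) $ None"
  have cl: "closure ?X = C h"
    using closure_rational_points[OF cell(4,7)[OF h]] cell(5)[OF h]
    by (simp add: compact_imp_closed)
  have "?g p = 0"
  proof (rule continuous_constant_on_closure[of ?X])
    show "continuous_on (closure ?X) ?g"
      unfolding cl using continuous_on_subset[OF continuous_unit cell(6)[OF h]]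
      by (intro continuous_intros continuous_on_homogeneous_None_row)
    fix q assume q: "q \<in> ?X"
    then have "q \<in> unit_cube" "rational_point q" using cell(6)[OF h] by auto
    \<comment> \<open>Both sides are \<open>den (S q)\<close>: the left one by
      \<open>den_dual_map\<close>, the right one by unimodularity of \<open>A h\<close>.\<close>
    then have "of_int (den q) * f\<^sub>1 q = of_int (den q) * (real_A h *v homogeneous q) $ None"
      using den_unimodular[OF det_A[OF h] _ dual_map_on_cell(1,2)[OF h, of q]] den_dual_map[of q] q
      by auto
    then show "?g q = 0" using primitive_coords(1)[OF \<open>rational_point q\<close>] by simp
  qed (use p cl in auto)
  then show ?thesis by simp
qed

lemma unit_on_cell_affine:
  "h \<in> {1..k} \<Longrightarrow> p \<in> C h \<Longrightarrow> f\<^sub>1 p = last_form (real_A h) \<bullet> p + real_A h $ None $ None"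
  using unit_on_cell homogeneous_None_row by metis

lemma dual_map_derivative:
  assumes h: "h \<in> {1..k}" and p: "p \<in> interior (C h)"
  obtains D where "(S has_derivative D) (at p)" "det (matrix D) = inverse (f\<^sub>1 p ^ (CARD('m) + 1))"
proof -
  have pC: "p \<in> C h" using p interior_subset by blast
  have l: "last_form (real_A h) \<bullet> p + real_A h $ None $ None = f\<^sub>1 p"
    using unit_on_cell_affine[OF h pC] by simp
  have "f\<^sub>1 p \<noteq> 0" using unit_pos[of p] cell(6)[OF h] pC by force
  then obtain D where D: "(projective_map (real_A h) has_derivative D) (at p)"
    "det (matrix D) = det (real_A h) * inverse (f\<^sub>1 p ^ (CARD('m) + 1))"
    using projective_map_derivative[OF l] by blast
  have "(S has_derivative D) (at p)"
    by (rule has_derivative_transform_within_open[OF D(1) open_interior p])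
       (use dual_map_on_cell(3)[OF h] interior_subset in \<open>metis subsetD\<close>)
  moreover have "det (real_A h) = 1"
    using det_A[OF h] by (simp add: det_map_matrix_of_int)
  ultimately show ?thesis using D(2) that by simp
qed

lemma jacobian_dual_map:
  assumes "h \<in> {1..k}" "p \<in> interior (C h)"
  shows "S differentiable (at p)"
    and "det (jacobian S (at p)) = inverse (f\<^sub>1 p ^ (CARD('m) + 1))"
proof -
  obtain D where D: "(S has_derivative D) (at p)" "det (matrix D) = inverse (f\<^sub>1 p ^ (CARD('m) + 1))"
    using dual_map_derivative[OF assms] by blast
  show "S differentiable (at p)" using D(1) by (auto simp: differentiable_def)
  show "det (jacobian S (at p)) = inverse (f\<^sub>1 p ^ (CARD('m) + 1))"
    using D(2) frechet_derivative_at[OF D(1)] by (simp add: jacobian_def)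
qed

section \<open>Conditions (a) to (d)\<close>

lemma unit_one_iff: "f\<^sub>1 = const_fun 1 \<longleftrightarrow> (\<forall>p\<in>unit_cube. f\<^sub>1 p = 1)"
proof
  assume "f\<^sub>1 = const_fun 1"
  then show "\<forall>p\<in>unit_cube. f\<^sub>1 p = 1" by (metis const_fun_def restrict_apply')
next
  assume "\<forall>p\<in>unit_cube. f\<^sub>1 p = 1"
  then show "f\<^sub>1 = const_fun 1"
    by (intro mcnaughton_eqI image_mem const_fun_mem_01) (auto simp: const_fun_def)
qed

lemma unit_one_iff_cells: "f\<^sub>1 = const_fun 1 \<longleftrightarrow> (\<forall>h\<in>{1..k}. \<forall>p\<in>C h. f\<^sub>1 p = 1)"
  unfolding unit_one_iff
proof (intro iffI ballI)
  fix p :: "real ^ 'm"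
  assume one: "\<forall>h\<in>{1..k}. \<forall>p\<in>C h. f\<^sub>1 p = 1" and "p \<in> unit_cube"
  then obtain h where "h \<in> {1..k}" "p \<in> C h" using cells_cover[of p] by blast
  then show "f\<^sub>1 p = 1" using one by blast
qed (use cell(6) in blast)

lemma den_iff:
  assumes "p \<in> unit_cube" "rational_point p"
  shows "den (S p) = den p \<longleftrightarrow> f\<^sub>1 p = 1"
proof -
  have "den (S p) = den p \<longleftrightarrow> of_int (den p) * f\<^sub>1 p = of_int (den p) * 1"
    using den_dual_map[OF assms] by (metis mult.right_neutral of_int_eq_iff)
  also have "\<dots> \<longleftrightarrow> f\<^sub>1 p = 1" using primitive_coords(1)[OF assms(2)] by simp
  finally show ?thesis .
qed

lemma vertex:
  assumes "p \<in> complex_vertices \<C>"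
  shows "p \<in> unit_cube" "rational_point p"
  using assms complex support
  by (auto simp: complex_vertices_def rational_cellular_complex_def extreme_point_of_def)

text \<open>On a cell \<open>f\<^sub>1\<close> is affine, so the points where it is 1 form a convex
  set. If this contains the extreme points of the cell, it contains their convex hull, which is the
  cell.\<close>

lemma unit_one_iff_den_vertices:
  "f\<^sub>1 = const_fun 1 \<longleftrightarrow> (\<forall>p\<in>complex_vertices \<C>. den (S p) = den p)"
proof
  assume "f\<^sub>1 = const_fun 1"
  then show "\<forall>p\<in>complex_vertices \<C>. den (S p) = den p"
    using vertex den_iff unfolding unit_one_iff by blast
next
  assume R: "\<forall>p\<in>complex_vertices \<C>. den (S p) = den p"
  have "f\<^sub>1 p = 1" if h: "h \<in> {1..k}" and p: "p \<in> C h" for h p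
  proof -
    let ?H = "{q. last_form (real_A h) \<bullet> q = 1 - real_A h $ None $ None}"
    have "v \<in> ?H" if v: "v extreme_point_of C h" for v
    proof -
      have vC: "v \<in> complex_vertices \<C>" using cell(1)[OF h] v by (auto simp: complex_vertices_def)
      then have "f\<^sub>1 v = 1" using R den_iff vertex by blast
      moreover have "v \<in> C h" using v by (simp add: extreme_point_of_def)
      ultimately show ?thesis using unit_on_cell_affine[OF h, of v] by simp
    qed
    then have "convex hull {v. v extreme_point_of C h} \<subseteq> ?H"
      by (intro hull_minimal convex_hyperplane) auto
    then have "p \<in> ?H" using Krein_Milman_Minkowski[OF cell(5,4)[OF h]] p by blast
    then show ?thesis using unit_on_cell_affine[OF h p] by simp
  qed
  then show "f\<^sub>1 = const_fun 1" unfolding unit_one_iff_cells by blast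
qed

lemma unit_one_iff_den:
  "f\<^sub>1 = const_fun 1 \<longleftrightarrow> (\<forall>p\<in>unit_cube. rational_point p \<longrightarrow> den (S p) = den p)"
  using unit_one_iff den_iff unit_one_iff_den_vertices vertex by blast

lemma unit_one_on_cell_iff:
  assumes h: "h \<in> {1..k}"
  shows "(\<forall>p\<in>C h. f\<^sub>1 p = 1) \<longleftrightarrow> last_form (real_A h) = 0 \<and> real_A h $ None $ None = 1"
proof
  assume one: "\<forall>p\<in>C h. f\<^sub>1 p = 1"
  let ?a = "last_form (real_A h)" and ?b = "real_A h $ None $ None"
  obtain p e where e: "e > 0" "ball p e \<subseteq> C h"
    using cell(7)[OF h] by (metis ex_in_conv mem_interior)
  have eq: "?a \<bullet> q + ?b = 1" if "q \<in> ball p e" for q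
    using one unit_on_cell_affine[OF h, of q] e(2) that by auto
  have "?a = 0"
  proof (rule ccontr)
    assume a: "?a \<noteq> 0"
    \<comment> \<open>A move of length e / 2 in the direction of \<open>?a\<close> stays in the ball
      and changes the affine form by \<open>s * (?a \<bullet> ?a)\<close>, which would have to be
      zero.\<close>
    define s where "s = e / (2 * norm ?a)"
    have "s > 0" using e a by (simp add: s_def)
    moreover have "norm (s *\<^sub>R ?a) = e / 2" using a e by (simp add: s_def)
    ultimately have "?a \<bullet> (p + s *\<^sub>R ?a) + ?b = 1"
      using e by (intro eq) (simp add: dist_norm)
    moreover have "?a \<bullet> p + ?b = 1" using e by (intro eq) simp
    ultimately have "s * (?a \<bullet> ?a) = 0"
      unfolding inner_right_distrib inner_scaleR_right by linarith
    then show False using a \<open>s > 0\<close> by simp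
  qed
  moreover have "?a \<bullet> p + ?b = 1" using e by (intro eq) simp
  ultimately show "?a = 0 \<and> ?b = 1" by simp
next
  assume "last_form (real_A h) = 0 \<and> real_A h $ None $ None = 1"
  then show "\<forall>p\<in>C h. f\<^sub>1 p = 1" using unit_on_cell_affine[OF h] by simp
qed

lemma unit_one_iff_last_row: "f\<^sub>1 = const_fun 1 \<longleftrightarrow> (\<forall>h\<in>{1..k}. row None (A h) = axis None 1)"
proof -
  have "last_form (real_A h) = 0 \<and> real_A h $ None $ None = 1 \<longleftrightarrow> row None (A h) = axis None 1" for h
    by (auto simp: vec_eq_iff row_def axis_def last_form_def split_option_all)
  then show ?thesis unfolding unit_one_iff_cells using unit_one_on_cell_iff by auto
qed

section \<open>Condition (e): Lebesgue measure\<close>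

lemma dual_map_image_measure:
  assumes h: "h \<in> {1..k}" and ab: "cbox a b \<subseteq> interior (C h)"
  shows "S ` cbox a b \<in> lmeasurable"
    and "((\<lambda>q. inverse (f\<^sub>1 q ^ (CARD('m) + 1))) has_integral measure lebesgue (S ` cbox a b)) (cbox a b)"
proof -
  let ?g = "\<lambda>q. inverse (f\<^sub>1 q ^ (CARD('m) + 1))"
  have sub: "cbox a b \<subseteq> unit_cube" using ab interior_subset cell(6)[OF h] by blast
  have "\<exists>D. (S has_derivative D) (at q) \<and> det (matrix D) = ?g q" if "q \<in> cbox a b" for q
    using dual_map_derivative[OF h, of q] ab that by blast
  then obtain D where D: "\<And>q. q \<in> cbox a b \<Longrightarrow> (S has_derivative D q) (at q)"
    "\<And>q. q \<in> cbox a b \<Longrightarrow> det (matrix (D q)) = ?g q" by metis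
  have "continuous_on (cbox a b) ?g"
    using continuous_on_subset[OF continuous_unit sub] unit_pos sub
    by (intro continuous_intros) force+
  then obtain I where I: "(?g has_integral I) (cbox a b)"
    using integrable_continuous by blast
  \<comment> \<open>Positivity of \<open>f\<^sub>1\<close> makes the determinant positive, so the
    change of variables integrates \<open>?g\<close> itself.\<close>
  have "\<bar>det (matrix (D q))\<bar> = ?g q" if "q \<in> cbox a b" for q
    using D(2)[OF that] unit_pos[of q] sub that by auto
  then have int: "((\<lambda>q. \<bar>det (matrix (D q))\<bar>) has_integral I) (cbox a b)"
    by (intro has_integral_eq[OF _ I]) simp
  have der: "(S has_derivative D q) (at q within cbox a b)" if "q \<in> cbox a b" for q
    using D(1)[OF that] by (rule has_derivative_at_withinI)
  have inj: "inj_on S (cbox a b)"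
    using bij_betw_dual_map sub by (auto simp: bij_betw_def intro: inj_on_subset)
  have bdd: "bounded (S ` cbox a b)"
  proof (rule bounded_subset)
    show "S ` cbox a b \<subseteq> unit_cube" using dual_map_in_cube sub by blast
  qed (simp add: unit_cube_def)
  note * = has_measure_differentiable_image_bounded[OF lmeasurable_cbox bounded_cbox bdd der inj int]
  show "S ` cbox a b \<in> lmeasurable" by (rule *(1))
  show "(?g has_integral measure lebesgue (S ` cbox a b)) (cbox a b)" using *(2) I by simp
qed

lemma unit_one_of_preserves_lebesgue:
  assumes pres: "preserves_lebesgue_on_cube S"
  shows "f\<^sub>1 = const_fun 1"
proof -
  let ?n = "CARD('m) + 1"
  let ?g = "\<lambda>q. inverse (f\<^sub>1 q ^ ?n)"
  have int1: "(?g has_integral measure lborel (cbox a b)) (cbox a b)"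
    if h: "h \<in> {1..k}" and ab: "cbox a b \<subseteq> interior (C h)" for h a b
  proof -
    have sub: "cbox a b \<subseteq> unit_cube" using ab interior_subset cell(6)[OF h] by blast
    note m = dual_map_image_measure[OF h ab]
    have "S -` (S ` cbox a b) \<inter> unit_cube = cbox a b"
      using bij_betw_dual_map sub by (auto simp: bij_betw_def dest: inj_onD)
    moreover have "S ` cbox a b \<subseteq> unit_cube" using dual_map_in_cube sub by blast
    ultimately have "emeasure lebesgue (S ` cbox a b) = emeasure lebesgue (cbox a b)"
      using pres m(1) unfolding preserves_lebesgue_on_cube_def by (metis fmeasurableD)
    then have "measure lebesgue (S ` cbox a b) = measure lborel (cbox a b)"
      by (simp add: measure_def)
    then show ?thesis using m(2) by simp
  qed
  have int0: "((\<lambda>q. ?g q - 1) has_integral 0) (cbox a b)"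
    if "h \<in> {1..k}" "cbox a b \<subseteq> interior (C h)" for h a b
    using has_integral_diff[OF int1[OF that] has_integral_const[of 1 a b]] by simp
  have one: "f\<^sub>1 p = 1" if h: "h \<in> {1..k}" and p: "p \<in> interior (C h)" for h p
  proof (rule ccontr)
    assume ne: "f\<^sub>1 p \<noteq> 1"
    \<comment> \<open>The points on the same side of 1 as p: one of the two implications holds
      vacuously, so both cases share one set.\<close>
    define W where "W = {q \<in> interior (C h). (f\<^sub>1 p > 1 \<longrightarrow> f\<^sub>1 q > 1) \<and> (f\<^sub>1 p < 1 \<longrightarrow> f\<^sub>1 q < 1)}"
    have sub: "interior (C h) \<subseteq> unit_cube" using interior_subset cell(6)[OF h] by blast
    have cont: "continuous_on (interior (C h)) f\<^sub>1"
      using continuous_on_subset[OF continuous_unit sub] .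
    have "open (interior (C h) \<inter> f\<^sub>1 -` {1<..})" "open (interior (C h) \<inter> f\<^sub>1 -` {..<1})"
      using continuous_open_preimage[OF cont open_interior] by auto
    moreover have "W = interior (C h) \<inter> f\<^sub>1 -` {1<..} \<or> W = interior (C h) \<inter> f\<^sub>1 -` {..<1}"
      using ne by (cases "f\<^sub>1 p > 1") (auto simp: W_def)
    ultimately have "open W" by auto
    moreover have "p \<in> W" using p by (simp add: W_def)
    ultimately obtain a b where ab: "cbox a b \<subseteq> W" "p \<in> box a b"
      using open_contains_cbox by metis
    have abC: "cbox a b \<subseteq> interior (C h)" using ab(1) by (auto simp: W_def)
    have pos: "f\<^sub>1 q > 0" if "q \<in> cbox a b" for q using that abC sub unit_pos by blast
    have "continuous_on (cbox a b) f\<^sub>1" using continuous_on_subset[OF cont abC] .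
    then have contg: "continuous_on (cbox a b) ?g"
      using pos by (intro continuous_intros) force+
    have cont1: "continuous_on (cbox a b) (\<lambda>q. ?g q - 1)"
      by (intro continuous_on_diff contg continuous_on_const)
    have pab: "p \<in> cbox a b" "box a b \<noteq> {}" using ab(2) box_subset_cbox by blast+
    \<comment> \<open>The vanishing criterion wants a nonnegative integrand: \<open>1 - ?g\<close>
      where \<open>f\<^sub>1\<close> exceeds 1, and \<open>?g - 1\<close> where it is
      smaller.\<close>
    have "?g p = 1"
    proof (cases "f\<^sub>1 p > 1")
      case True
      have "?g q \<le> 1" if "q \<in> box a b" for q
      proof -
        have "f\<^sub>1 q > 1" using that ab(1) box_subset_cbox True by (auto simp: W_def)
        then have "f\<^sub>1 q ^ ?n \<ge> 1" by (intro one_le_power) simp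
        then show ?thesis by (simp only: inverse_le_1_iff simp_thms)
      qed
      then have "- (?g p - 1) = 0"
        by (intro has_integral_0_cbox_imp_0[OF continuous_on_minus[OF cont1] _
              has_integral_neg[OF int0[OF h abC], simplified minus_zero] pab(2,1)]) simp
      then show ?thesis by simp
    next
      case False
      have "1 \<le> ?g q" if "q \<in> box a b" for q
      proof -
        have q: "q \<in> cbox a b" using that box_subset_cbox by blast
        then have "f\<^sub>1 q < 1" using ab(1) False ne by (auto simp: W_def)
        then have "f\<^sub>1 q ^ ?n \<le> 1" "f\<^sub>1 q ^ ?n > 0" using pos[OF q] by (intro power_le_one zero_less_power; simp)+
        then show ?thesis by (intro one_le_inverse)
      qed
      then have "?g p - 1 = 0"
        by (intro has_integral_0_cbox_imp_0[OF cont1 _ int0[OF h abC] pab(2,1)]) simp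
      then show ?thesis by simp
    qed
    then have "f\<^sub>1 p ^ ?n = 1" by (metis inverse_eq_1_iff)
    then have "f\<^sub>1 p = 1" using pos[OF pab(1)] power_eq_iff_eq_base[of ?n "f\<^sub>1 p" 1] by simp
    then show False using ne by simp
  qed
  have "f\<^sub>1 p = 1" if h: "h \<in> {1..k}" and p: "p \<in> C h" for h p
  proof (rule continuous_constant_on_closure[of "interior (C h)"])
    have cl: "closure (interior (C h)) = C h"
      using convex_closure_interior[OF cell(4,7)[OF h]] cell(5)[OF h] by (simp add: compact_imp_closed)
    then show "p \<in> closure (interior (C h))" using p by simp
    show "continuous_on (closure (interior (C h))) f\<^sub>1"
      unfolding cl using continuous_on_subset[OF continuous_unit cell(6)[OF h]] .
  qed (rule one[OF h])
  then show ?thesis unfolding unit_one_iff_cells by blast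
qed

text \<open>The intersection is a face of both cells and, as they differ, a proper face of at least
  one of them; so its dimension drops.\<close>

lemma cells_negligible_Int:
  assumes "h \<in> {1..k}" "h' \<in> {1..k}" "h \<noteq> h'"
  shows "negligible (C h \<inter> C h')"
proof -
  have ne: "C h \<noteq> C h'"
    using inj_onD[OF bij_betw_imp_inj_on[OF cells] _ assms(1,2)] assms(3) by blast
  have f: "(C h \<inter> C h') face_of C h" "(C h \<inter> C h') face_of C h'"
    using complex cell(1)[OF assms(1)] cell(1)[OF assms(2)]
    unfolding rational_cellular_complex_def by blast+
  have "C h \<inter> C h' \<noteq> C h \<or> C h \<inter> C h' \<noteq> C h'" using ne by auto
  then have "aff_dim (C h \<inter> C h') < int CARD('m)"
    using face_of_aff_dim_lt[OF cell(4)[OF assms(1)] f(1)] face_of_aff_dim_lt[OF cell(4)[OF assms(2)] f(2)]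
      cell(2)[OF assms(1)] cell(2)[OF assms(2)] by auto
  then show ?thesis
    using negligible_cell_iff[of "C h \<inter> C h'"] cell(4)[OF assms(1)] cell(4)[OF assms(2)]
    by (simp add: convex_Int)
qed

text \<open>Once the last rows are trivial, \<open>S\<close> is on each cell an affine map of
  determinant 1. \<open>T\<close> and its preimage are cut into corresponding pieces of equal
  measure. The pieces of the preimage overlap inside common faces, those of \<open>T\<close> inside
  affine images of such faces, and both are negligible.\<close>

lemma preserves_lebesgue_of_unit_one:
  assumes one: "f\<^sub>1 = const_fun 1"
  shows "preserves_lebesgue_on_cube S"
  unfolding preserves_lebesgue_on_cube_def
proof (intro ballI impI)
  fix T :: "(real ^ 'm) set" assume T: "T \<in> sets lebesgue" "T \<subseteq> unit_cube"
  define F where "F h q = linear_block (real_A h) *v q + translation_block (real_A h)" for h and q :: "real ^ 'm"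
  define U where "U = S -` T \<inter> unit_cube"
  have last: "last_form (real_A h) = 0" "real_A h $ None $ None = 1" if h: "h \<in> {1..k}" for h
    using one unit_one_on_cell_iff[OF h] h unfolding unit_one_iff_cells by blast+
  have SF: "S q = F h q" if "h \<in> {1..k}" "q \<in> C h" for h q
    using dual_map_on_cell(3)[OF that] last[OF that(1)] by (simp add: projective_map_def F_def)
  have F_der: "(F h has_derivative (*v) (linear_block (real_A h))) (at q within X)" for h q X
    unfolding F_def using has_derivative_add[OF bounded_linear_imp_has_derivative has_derivative_const]
    by force
  have F_cont: "continuous_on X (F h)" for h X
    by (rule has_derivative_continuous_on) (rule F_der)
  have det_M: "det (linear_block (real_A h)) = 1" if h: "h \<in> {1..k}" for h
  proof -
    \<comment> \<open>\<open>det_option_last_column\<close> wants zeros in the last column; here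
      they stand in the last row, hence the transpose.\<close>
    have "transpose (real_A h) $ Some i $ None = 0" for i
      using last(1)[OF h] by (simp add: transpose_def last_form_def vec_eq_iff)
    then have "det (transpose (real_A h)) = transpose (real_A h) $ None $ None *
        det (\<chi> i j. transpose (real_A h) $ Some i $ Some j)"
      by (rule det_option_last_column)
    also have "(\<chi> i j. transpose (real_A h) $ Some i $ Some j) = transpose (linear_block (real_A h))"
      by (simp add: vec_eq_iff transpose_def linear_block_def)
    finally show ?thesis
      using det_A[OF h] last(2)[OF h] by (simp add: det_map_matrix_of_int) (simp add: transpose_def)
  qed
  have Tm: "T \<in> lmeasurable"
    using T bounded_subset[of unit_cube T] by (intro bounded_set_imp_lmeasurable) (auto simp: unit_cube_def)
  define Th where "Th h = T \<inter> S ` C h" for h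
  have piece: "U \<inter> C h \<in> lmeasurable \<and> Th h \<in> lmeasurable \<and>
      measure lebesgue (U \<inter> C h) = measure lebesgue (Th h)" if h: "h \<in> {1..k}" for h
  proof -
    let ?M = "linear_block (real_A h)" and ?t = "translation_block (real_A h)"
    have "S ` C h = F h ` C h" using SF[OF h] by auto
    then have "compact (S ` C h)"
      using compact_continuous_image[OF F_cont cell(5)[OF h]] by simp
    then have Thm: "Th h \<in> lmeasurable"
      unfolding Th_def by (intro fmeasurable.Int[OF Tm lmeasurable_compact])
    have "invertible ?M" using det_M[OF h] by (simp add: invertible_det_nz)
    then obtain B where B: "B ** ?M = mat 1" "?M ** B = mat 1" unfolding invertible_def by blast
    have "det B * det ?M = 1" unfolding det_mul[symmetric] B by simp
    then have det_B: "det B = 1" using det_M[OF h] by simp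
    \<comment> \<open>The change of variables runs along the inverse affine map: measurability is
      known for \<open>Th h\<close> and has to be derived for \<open>U \<inter> C h\<close>.\<close>
    define G where "G y = B *v (y - ?t)" for y
    have GF: "G (F h q) = q" for q
      by (simp add: G_def F_def matrix_vector_mul_assoc B)
    have FG: "F h (G y) = y" for y
      by (simp add: G_def F_def matrix_vector_mul_assoc B)
    have eq: "G ` Th h = U \<inter> C h"
    proof (intro equalityI subsetI)
      fix q assume "q \<in> G ` Th h"
      then obtain x where "x \<in> C h" "S x \<in> T" "q = G (S x)" by (auto simp: Th_def)
      then show "q \<in> U \<inter> C h" using SF[OF h] GF cell(6)[OF h] by (auto simp: U_def)
    next
      fix q assume "q \<in> U \<inter> C h"
      then have "S q \<in> Th h" "q = G (S q)" using SF[OF h] GF by (auto simp: U_def Th_def)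
      then show "q \<in> G ` Th h" by blast
    qed
    have der: "(G has_derivative (*v) B) (at y within Th h)" for y
    proof -
      have "((\<lambda>y. y - ?t) has_derivative (\<lambda>v. v)) (at y within Th h)"
        by (auto intro!: derivative_eq_intros)
      then show ?thesis
        unfolding G_def using bounded_linear.has_derivative[OF matrix_vector_mul_bounded_linear] by blast
    qed
    have "((\<lambda>y. 1) has_integral measure lebesgue (Th h)) (Th h)"
      using Thm by (simp add: lmeasure_integral lmeasurable_iff_integrable_on integrable_integral)
    then have int: "((\<lambda>y. \<bar>det (matrix ((*v) B))\<bar>) has_integral measure lebesgue (Th h)) (Th h)"
      by (simp add: det_B)
    have bdd: "bounded (Th h)" "bounded (G ` Th h)"
      unfolding eq using T(2) bounded_subset[of unit_cube] by (auto simp: Th_def U_def unit_cube_def)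
    have inj: "inj_on G (Th h)" by (metis FG inj_onI)
    show ?thesis
      using has_measure_differentiable_image_bounded[OF Thm bdd der inj int] Thm unfolding eq by blast
  qed
  have U_eq: "U = (\<Union>h\<in>{1..k}. U \<inter> C h)"
  proof (intro equalityI subsetI)
    fix q assume q: "q \<in> U"
    then obtain h where "h \<in> {1..k}" "q \<in> C h" using cells_cover[of q] by (auto simp: U_def)
    then show "q \<in> (\<Union>h\<in>{1..k}. U \<inter> C h)" using q by blast
  qed blast
  have T_eq: "T = (\<Union>h\<in>{1..k}. Th h)"
  proof (intro equalityI subsetI)
    fix y assume y: "y \<in> T"
    then obtain q where q: "q \<in> unit_cube" "y = S q"
      using T(2) bij_betw_dual_map by (auto simp: bij_betw_def)
    obtain h where "h \<in> {1..k}" "q \<in> C h" using cells_cover[OF q(1)] by blast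
    then show "y \<in> (\<Union>h\<in>{1..k}. Th h)" using y q by (auto simp: Th_def)
  qed (auto simp: Th_def)
  have negU: "pairwise (\<lambda>h h'. negligible ((U \<inter> C h) \<inter> (U \<inter> C h'))) {1..k}"
    using cells_negligible_Int unfolding pairwise_def
    by (metis (no_types, lifting) inf_le2 inf_mono negligible_subset)
  have negT: "pairwise (\<lambda>h h'. negligible (Th h \<inter> Th h')) {1..k}"
  proof (rule pairwiseI)
    fix h h' assume h: "h \<in> {1..k}" "h' \<in> {1..k}" "h \<noteq> h'"
    have "negligible (F h ` (C h \<inter> C h'))"
      using F_der cells_negligible_Int[OF h]
      by (intro negligible_differentiable_image_negligible) (auto simp: differentiable_on_def differentiable_def)
    \<comment> \<open>By injectivity of \<open>S\<close>, a point common to both pieces has a single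
      preimage, which then lies in both cells.\<close>
    moreover have "Th h \<inter> Th h' \<subseteq> F h ` (C h \<inter> C h')"
    proof
      fix y assume "y \<in> Th h \<inter> Th h'"
      then obtain q q' where q: "q \<in> C h" "q' \<in> C h'" "y = S q" "y = S q'" by (auto simp: Th_def)
      then have "q = q'"
        using bij_betw_dual_map cell(6)[OF h(1)] cell(6)[OF h(2)]
        by (auto simp: bij_betw_def dest!: inj_onD)
      then show "y \<in> F h ` (C h \<inter> C h')" using q SF[OF h(1)] by auto
    qed
    ultimately show "negligible (Th h \<inter> Th h')" using negligible_subset by blast
  qed
  have Um: "U \<in> lmeasurable"
    by (subst U_eq, rule fmeasurable.finite_UN) (use piece in auto)
  have "measure lebesgue U = (\<Sum>h\<in>{1..k}. measure lebesgue (U \<inter> C h))"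
    by (subst U_eq, rule measure_negligible_finite_Union_image) (use piece negU in auto)
  also have "\<dots> = (\<Sum>h\<in>{1..k}. measure lebesgue (Th h))" using piece by simp
  also have "\<dots> = measure lebesgue T"
    by (subst T_eq, rule measure_negligible_finite_Union_image[symmetric]) (use piece negT in auto)
  finally have "emeasure lebesgue U = emeasure lebesgue T"
    using Um Tm by (simp add: emeasure_eq_measure2)
  then show "S -` T \<inter> unit_cube \<in> sets lebesgue \<and>
      emeasure lebesgue T = emeasure lebesgue (S -` T \<inter> unit_cube)"
    using Um unfolding U_def by (simp add: fmeasurableD)
qed

end

theorem theorem4p3:
  fixes \<sigma> :: "(real ^ 'm \<Rightarrow> real) \<Rightarrow> (real ^ 'm \<Rightarrow> real)"
    and S :: "real ^ 'm \<Rightarrow> real ^ 'm"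
    and \<C> :: "(real ^ 'm) set set"
    and k :: nat
    and C :: "nat \<Rightarrow> (real ^ 'm) set"
    and A :: "nat \<Rightarrow> int ^ 'm option ^ 'm option"
  assumes "hoop_automorphism \<sigma>"
    and "S = dual_map \<sigma>"
    and "orientation_preserving_on_cube S"
    and "rational_cellular_complex \<C>"
    and "\<Union>\<C> = unit_cube"
    and "bij_betw C {1..k} {D \<in> \<C>. aff_dim D = int CARD('m)}"
    and "\<And>h. h \<in> {1..k} \<Longrightarrow> det (A h) = 1"
    and "\<And>h. h \<in> {1..k} \<Longrightarrow> expresses_on (A h) S (C h)"
  shows "(\<forall>h\<in>{1..k}. \<forall>p\<in>interior (C h).
            S differentiable (at p) \<and>
            det (jacobian S (at p)) = inverse (\<sigma> (const_fun 1) p ^ (CARD('m) + 1))) \<and>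
         (\<sigma> (const_fun 1) = const_fun 1 \<longleftrightarrow> restricts_to_mv_automorphism \<sigma>) \<and>
         (\<sigma> (const_fun 1) = const_fun 1 \<longleftrightarrow>
            (\<forall>p\<in>unit_cube. rational_point p \<longrightarrow> den (S p) = den p)) \<and>
         (\<sigma> (const_fun 1) = const_fun 1 \<longleftrightarrow>
            (\<forall>p\<in>complex_vertices \<C>. den (S p) = den p)) \<and>
         (\<sigma> (const_fun 1) = const_fun 1 \<longleftrightarrow>
            (\<forall>h\<in>{1..k}. row None (A h) = axis None 1)) \<and>
         (\<sigma> (const_fun 1) = const_fun 1 \<longleftrightarrow> preserves_lebesgue_on_cube S)"
proof -
  interpret expressed_hoop_aut \<sigma> \<C> k C A
    using assms by unfold_locales simp_all
  show ?thesis
    unfolding \<open>S = dual_map \<sigma>\<close>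
    using jacobian_dual_map mv_automorphism_iff unit_one_iff_den unit_one_iff_den_vertices
      unit_one_iff_last_row unit_one_of_preserves_lebesgue preserves_lebesgue_of_unit_one
    by blast
qed

end
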